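(* Let $F$ be a finite pin-jointed bar framework in Euclidean $3$-space, with pairwise distinct joint positions and more than three joints, that is isostatic in $3$-space, and let $\mathcal{G}$ be its point group of symmetries. Then: (i) $b=3j-6$. (ii) For each reflection $\sigma\in\mathcal{G}$, $b_\sigma=j_\sigma$. (iii) If $\mathcal{G}$ contains an inversion $i$, then $j_c=0$ and $b_c=0$. (iv) For each half-turn $C_2\in\mathcal{G}$, $(j_2,b_2)\in\{(2,0),(1,1),(0,2)\}$, and every bar unshifted by this half-turn is perpendicular to its axis (no bar lies along the axis). (v) For each rotation $C_n\in\mathcal{G}$ with $n>2$, $b_n=0$; and if $n\neq 3$, then $j_n=2$. (vi) For each improper rotation $S_n\in\mathcal{G}$ with $n>2$, $j_c=0$ and $b_{nc}=0$. (vii) If $\mathcal{G}$ is $\mathcal{I}$ or $\mathcal{I}_h$, then $j_5=2$ for each $5$-fold axis, and the framework includes a single orbit of $12$ joints that are the vertices of an icosahedron. If $\mathcal{G}$ is $\mathcal{O}$ or $\mathcal{O}_h$, then $j_4=2$ for each $4$-fold axis, and the framework includes a single orbit of $6$ joints that are the vertices of an octahedron.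
   Context: A framework in $3$-space consists of a finite simple graph with joint set $J$ ($|J|=j$) and bar set $B$ ($|B|=b$), together with an injective map $p$ from $J$ to $\mathbb{R}^3$. Its compatibility matrix $\mathbf{C}$ is the $b\times 3j$ matrix sending infinitesimal joint displacements to infinitesimal bar extensions; up to multiplying each row by the length of the corresponding bar it is the rigidity matrix, whose row for a bar $\{u,v\}$ has $p(u)-p(v)$ in the columns of $u$, $p(v)-p(u)$ in the columns of $v$, and $0$ elsewhere. Let $r=\operatorname{rank}\mathbf{C}$. The number of states of self-stress is $s=b-r$, and the number of infinitesimal internal mechanisms $m$ is defined by $m+6=3j-r$ (the $6$ counts rigid-body motions in $3$-space). The framework is isostatic if $m=s=0$. The point group $\mathcal{G}$ of the framework is the group of isometries of $\mathbb{R}^3$ that permute the joint positions and map bars to bars. The symmetry operations are: the identity; the proper rotation $C_n$ by $2\pi/n$ about an axis ($C_2$ is a half-turn); the improper rotation $S_n$, which is $C_n$ followed by reflection in the plane perpendicular to the axis through the central point; the reflection $\sigma=S_1$ in a plane; and the inversion $i=S_2$ in a point. $\mathcal{I}$ and $\mathcal{O}$ are the rotation groups of the regular icosahedron and octahedron, and $\mathcal{I}_h$, $\mathcal{O}_h$ their full symmetry groups. A joint is unshifted by an operation if it is mapped to itself; a bar is unshifted if it is mapped to itself (possibly with its two ends interchanged). All counts refer to a particular symmetry element: $j_n$ is the number of joints lying on the axis of the given $C_n$ ($n\ge 2$); $j_c$ is the number of joints (0 or 1) at the central point fixed by $i$ or by $S_n$, $n>2$; $j_\sigma$ is the number of joints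 lying in the given mirror plane; $b_2$ is the number of bars unshifted by the given $C_2$ (bars lying along the axis, or perpendicular to and centred on the axis); $b_n$ ($n>2$) is the number of bars unshifted by the given $C_n$ (such bars lie along the axis); $b_\sigma$ is the number of bars unshifted by the given reflection (bars lying in the plane, or perpendicular to it with midpoint in it); $b_c$ is the number of bars unshifted by $i$ (bars with midpoint at the inversion centre); $b_{nc}$ is the number of bars unshifted by the given $S_n$, $n>2$ (bars along the axis with midpoint at the central point). *)

theory Defs
  imports "HOL-Analysis.Analysis"
begin

section \<open>Frameworks in 3-space\<close>

text \<open>
  The joints are the elements of a finite type \<open>'j\<close>, the bars those of a finite type \<open>'b\<close>;
  \<open>ends e\<close> is the two-element set of joints connected by the bar \<open>e\<close>. Injectivity of \<open>ends\<close>
  excludes multiple bars. The type \<open>'b\<close> cannot be empty, which excludes no isostatic framework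
  with more than three joints, since such a framework has \<open>3j - 6 > 0\<close> bars.
\<close>

definition framework :: "('b::finite \<Rightarrow> 'j::finite set) \<Rightarrow> ('j \<Rightarrow> real^3) \<Rightarrow> bool" where
  "framework ends p \<longleftrightarrow> inj ends \<and> (\<forall>e. card (ends e) = 2) \<and> inj p"

definition other_end :: "('b \<Rightarrow> 'j set) \<Rightarrow> 'b \<Rightarrow> 'j \<Rightarrow> 'j" where
  "other_end ends e v = (THE w. ends e = {v, w})"

text \<open>
  To first order, under joint displacements \<open>d\<close>, the bar with ends \<open>u\<close>, \<open>v\<close> is extended by
  \<open>((p u - p v) /\<^sub>R norm (p u - p v)) \<bullet> (d u - d v)\<close>.
\<close>

definition compat_matrix ::
    "('b::finite \<Rightarrow> 'j::finite set) \<Rightarrow> ('j \<Rightarrow> real^3) \<Rightarrow> real^('j \<times> 3)^'b" where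
  "compat_matrix ends p = (\<chi> e vk. case vk of (v, k) \<Rightarrow>
     if v \<in> ends e
     then (p v - p (other_end ends e v)) $ k / norm (p v - p (other_end ends e v))
     else 0)"

definition self_stresses :: "('b::finite \<Rightarrow> 'j::finite set) \<Rightarrow> ('j \<Rightarrow> real^3) \<Rightarrow> int" where
  "self_stresses ends p = int CARD('b) - int (rank (compat_matrix ends p))"

definition mechanisms :: "('b::finite \<Rightarrow> 'j::finite set) \<Rightarrow> ('j \<Rightarrow> real^3) \<Rightarrow> int" where
  "mechanisms ends p = 3 * int CARD('j) - int (rank (compat_matrix ends p)) - 6"

definition isostatic :: "('b::finite \<Rightarrow> 'j::finite set) \<Rightarrow> ('j \<Rightarrow> real^3) \<Rightarrow> bool" where
  "isostatic ends p \<longleftrightarrow> mechanisms ends p = 0 \<and> self_stresses ends p = 0"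

section \<open>Isometries and symmetry operations\<close>

definition isometry :: "(real^3 \<Rightarrow> real^3) \<Rightarrow> bool" where
  "isometry f \<longleftrightarrow> (\<forall>x y. dist (f x) (f y) = dist x y)"

definition proper_isometry :: "(real^3 \<Rightarrow> real^3) \<Rightarrow> bool" where
  "proper_isometry f \<longleftrightarrow> (\<exists>Q c. rotation_matrix Q \<and> f = (\<lambda>x. c + Q *v x))"

definition axis_line :: "real^3 \<Rightarrow> real^3 \<Rightarrow> (real^3) set" where
  "axis_line c u = {c + t *\<^sub>R u | t. True}"

definition perp_plane :: "real^3 \<Rightarrow> real^3 \<Rightarrow> (real^3) set" where
  "perp_plane c u = {x. u \<bullet> (x - c) = 0}"

text \<open>
  Rodrigues' formula for \<open>C\<^sub>n\<close>, the rotation by \<open>2\<pi>/n\<close> about the axis through \<open>c\<close> with unit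
  direction \<open>u\<close>. Replacing \<open>u\<close> by \<open>-u\<close> reverses the sense of rotation about the same axis.
\<close>

definition rotation_C :: "nat \<Rightarrow> real^3 \<Rightarrow> real^3 \<Rightarrow> real^3 \<Rightarrow> real^3" where
  "rotation_C n c u x =
     c + cos (2 * pi / real n) *\<^sub>R (x - c)
       + sin (2 * pi / real n) *\<^sub>R cross3 u (x - c)
       + ((1 - cos (2 * pi / real n)) * (u \<bullet> (x - c))) *\<^sub>R u"

definition reflection :: "real^3 \<Rightarrow> real^3 \<Rightarrow> real^3 \<Rightarrow> real^3" where
  "reflection c u x = x - (2 * (u \<bullet> (x - c))) *\<^sub>R u"

definition inversion :: "real^3 \<Rightarrow> real^3 \<Rightarrow> real^3" where
  "inversion c x = c - (x - c)"

definition improper_S :: "nat \<Rightarrow> real^3 \<Rightarrow> real^3 \<Rightarrow> real^3 \<Rightarrow> real^3" where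
  "improper_S n c u = reflection c u \<circ> rotation_C n c u"

lemma improper_S_1: "improper_S 1 c u = reflection c u"
  by (simp add: fun_eq_iff improper_S_def rotation_C_def)

lemma improper_S_2:
  assumes "norm u = 1"
  shows "improper_S 2 c u = inversion c"
proof
  fix x
  have "u \<bullet> u = 1" using assms by (simp add: norm_eq_1)
  then show "improper_S 2 c u x = inversion c x"
    by (simp add: improper_S_def rotation_C_def reflection_def inversion_def
        inner_simps algebra_simps scaleR_left_diff_distrib)
qed

section \<open>The point group of a framework and unshifted joints and bars\<close>

definition point_group ::
    "('b::finite \<Rightarrow> 'j::finite set) \<Rightarrow> ('j \<Rightarrow> real^3) \<Rightarrow> (real^3 \<Rightarrow> real^3) set" where
  "point_group ends p = {f. isometry f \<and> f ` range p = range p \<and>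
     (\<forall>e. \<exists>e'. f ` p ` ends e = p ` ends e')}"

definition joints_in :: "('j \<Rightarrow> real^3) \<Rightarrow> (real^3) set \<Rightarrow> 'j set" where
  "joints_in p X = {v. p v \<in> X}"

definition unshifted_bars ::
    "('b \<Rightarrow> 'j set) \<Rightarrow> ('j \<Rightarrow> real^3) \<Rightarrow> (real^3 \<Rightarrow> real^3) \<Rightarrow> 'b set" where
  "unshifted_bars ends p f = {e. f ` p ` ends e = p ` ends e}"

definition joint_orbits :: "(real^3 \<Rightarrow> real^3) set \<Rightarrow> ('j \<Rightarrow> real^3) \<Rightarrow> (real^3) set set" where
  "joint_orbits G p = (\<lambda>x. (\<lambda>f. f x) ` G) ` range p"

section \<open>The regular icosahedron and octahedron and their groups\<close>

definition similar :: "(real^3) set \<Rightarrow> (real^3) set \<Rightarrow> bool" where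
  "similar V W \<longleftrightarrow>
     (\<exists>r c Q. r > 0 \<and> orthogonal_matrix Q \<and> W = (\<lambda>x. c + r *\<^sub>R (Q *v x)) ` V)"

definition std_icosahedron :: "(real^3) set" where
  "std_icosahedron = (let g = (1 + sqrt 5) / 2 in
     (\<Union>s \<in> {-1, 1}. \<Union>t \<in> {-1, 1}.
        {vector [0, s, t * g], vector [s, t * g, 0], vector [t * g, 0, s]}))"

definition std_octahedron :: "(real^3) set" where
  "std_octahedron = Basis \<union> uminus ` Basis"

definition icosahedron_vertices :: "(real^3) set \<Rightarrow> bool" where
  "icosahedron_vertices V \<longleftrightarrow> similar std_icosahedron V"

definition octahedron_vertices :: "(real^3) set \<Rightarrow> bool" where
  "octahedron_vertices V \<longleftrightarrow> similar std_octahedron V"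

definition full_group :: "(real^3) set \<Rightarrow> (real^3 \<Rightarrow> real^3) set" where
  "full_group V = {f. isometry f \<and> f ` V = V}"

definition rotation_group :: "(real^3) set \<Rightarrow> (real^3 \<Rightarrow> real^3) set" where
  "rotation_group V = {f. proper_isometry f \<and> f ` V = V}"

definition is_I :: "(real^3 \<Rightarrow> real^3) set \<Rightarrow> bool" where
  "is_I G \<longleftrightarrow> (\<exists>V. icosahedron_vertices V \<and> G = rotation_group V)"

definition is_Ih :: "(real^3 \<Rightarrow> real^3) set \<Rightarrow> bool" where
  "is_Ih G \<longleftrightarrow> (\<exists>V. icosahedron_vertices V \<and> G = full_group V)"

definition is_O :: "(real^3 \<Rightarrow> real^3) set \<Rightarrow> bool" where
  "is_O G \<longleftrightarrow> (\<exists>V. octahedron_vertices V \<and> G = rotation_group V)"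

definition is_Oh :: "(real^3 \<Rightarrow> real^3) set \<Rightarrow> bool" where
  "is_Oh G \<longleftrightarrow> (\<exists>V. octahedron_vertices V \<and> G = full_group V)"

end

theory Submission
  imports Defs
begin

text \<open>
  In an isostatic framework the map sending bar tensions \<open>l\<close> and an infinitesimal rigid motion
  \<open>x \<mapsto> a + w \<times> x\<close> to \<open>C\<^sup>T l\<close> plus the velocities of the joints is bijective: its two
  summands are orthogonal, \<open>C\<^sup>T\<close> is injective since there is no self-stress, and the joints
  are not collinear. It intertwines the actions of every symmetry, so comparing traces gives
  \<open>j \<sqdot> tr A = b + tr A + det A \<sqdot> tr A\<close>, where \<open>A\<close> is the linear part and \<open>j\<close>, \<open>b\<close> count the
  unshifted joints and bars. Everything up to the statements on icosahedra and octahedra follows by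
  evaluating this for a symmetry and its powers. For these last ones, the two joints on a 5-fold
  (4-fold) axis are exchanged by a rotation of the group and hence span an orbit of 12 (6) vertices;
  any other orbit of that size would meet the axis as well, since rotation by \<open>2\<pi>/n\<close> moves the points
  off the axis in cycles of length \<open>n\<close>.
\<close>

section \<open>The trace formula\<close>

text \<open>Taken for linear maps rather than matrices because the domain of
  \<open>stress_motion\<close> is a product space, whose coordinates carry no single finite index
  type.\<close>

definition lin_trace :: "('a::euclidean_space \<Rightarrow> 'a) \<Rightarrow> real" where
  "lin_trace f = (\<Sum>b\<in>Basis. f b \<bullet> b)"

text \<open>In coordinates both traces are one double sum of entries of \<open>f\<close> times
  entries of \<open>g\<close>, with the order of summation exchanged.\<close>

lemma lin_trace_comp_commute:
  fixes f :: "'a::euclidean_space \<Rightarrow> 'b::euclidean_space" and g :: "'b \<Rightarrow> 'a"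
  assumes "linear f" "linear g"
  shows "lin_trace (g \<circ> f) = lin_trace (f \<circ> g)"
proof -
  have expand: "h x \<bullet> y = (\<Sum>c\<in>Basis. (x \<bullet> c) * (h c \<bullet> y))"
    if "linear h" for h :: "'c::euclidean_space \<Rightarrow> 'd::euclidean_space" and x y
  proof -
    have "h x = h (\<Sum>c\<in>Basis. (x \<bullet> c) *\<^sub>R c)"
      by (simp add: euclidean_representation)
    also have "\<dots> = (\<Sum>c\<in>Basis. (x \<bullet> c) *\<^sub>R h c)"
      by (simp add: linear_sum[OF that] linear_cmul[OF that])
    finally show ?thesis by (simp add: inner_sum_left)
  qed
  have "lin_trace (g \<circ> f) = (\<Sum>b\<in>Basis. \<Sum>c\<in>Basis. (f b \<bullet> c) * (g c \<bullet> b))"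
    unfolding lin_trace_def o_def by (subst expand[OF assms(2)]) simp
  also have "\<dots> = (\<Sum>c\<in>Basis. \<Sum>b\<in>Basis. (g c \<bullet> b) * (f b \<bullet> c))"
    by (subst sum.swap) (simp add: mult.commute)
  also have "\<dots> = lin_trace (f \<circ> g)"
    unfolding lin_trace_def o_def by (subst (2) expand[OF assms(1)]) simp
  finally show ?thesis .
qed

text \<open>The inverse \<open>k\<close> of \<open>h\<close> exhibits \<open>g\<close> as the
  conjugate \<open>h \<circ> f \<circ> k\<close>, and commuting factors under the trace cancels
  \<open>h\<close> against \<open>k\<close>.\<close>

lemma lin_trace_intertwine:
  fixes h :: "'a::euclidean_space \<Rightarrow> 'b::euclidean_space"
  assumes "linear h" "bij h" "linear f" and comm: "\<And>x. g (h x) = h (f x)"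
  shows "lin_trace g = lin_trace f"
proof -
  obtain k where k: "linear k" "k \<circ> h = id"
    using linear_injective_left_inverse[of h] assms(1,2) by (auto simp: bij_is_inj)
  have hk: "h (k y) = y" for y
    using k(2) bij_is_surj[OF assms(2)] by (metis comp_apply id_apply surjD)
  have "g = h \<circ> (f \<circ> k)"
  proof
    fix y show "g y = (h \<circ> (f \<circ> k)) y" using comm[of "k y"] by (simp add: hk)
  qed
  then have "lin_trace g = lin_trace ((f \<circ> k) \<circ> h)"
    using assms k by (simp only:) (intro lin_trace_comp_commute linear_compose)
  also have "(f \<circ> k) \<circ> h = f"
    using k(2) by (simp add: o_assoc[symmetric])
  finally show ?thesis .
qed

lemma lin_trace_matrix: "lin_trace ((*v) A) = trace A" for A :: "real^'n^'n"
proof -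
  have B: "Basis = range (\<lambda>k::'n. axis k (1::real))" by (auto simp: Basis_vec_def)
  have "lin_trace ((*v) A) = (\<Sum>k\<in>UNIV. (A *v axis k 1) \<bullet> axis k 1)"
    unfolding lin_trace_def B by (subst sum.reindex) (auto simp: inj_on_def axis_eq_axis)
  also have "\<dots> = trace A"
    by (simp add: trace_def inner_axis matrix_vector_mult_basis column_def)
  finally show ?thesis .
qed

lemma lin_trace_prod:
  fixes f :: "'a::euclidean_space \<times> 'b::euclidean_space \<Rightarrow> 'a \<times> 'b"
  shows "lin_trace f = lin_trace (\<lambda>x. fst (f (x, 0))) + lin_trace (\<lambda>y. snd (f (0, y)))"
  unfolding lin_trace_def Basis_prod_def
  by (subst sum.union_disjoint) (auto simp: sum.reindex inj_on_def inner_prod_def)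

lemma inv_permutation_eq_self: "bij \<pi> \<Longrightarrow> inv \<pi> i = i \<longleftrightarrow> \<pi> i = i"
  by (metis bij_inv_eq_iff)

text \<open>In block form, row \<open>i\<close> has its only block \<open>L\<close> in column
  \<open>inv \<pi> i\<close>, which lies on the diagonal exactly when \<open>i\<close> is fixed. The
  inverse occurs because the entry at \<open>i\<close> is carried to \<open>\<pi> i\<close>.\<close>

lemma lin_trace_permute:
  fixes L :: "'a::euclidean_space \<Rightarrow> 'a"
  assumes "bij \<pi>" "L 0 = 0"
  shows "lin_trace (\<lambda>d::'a^'n. \<chi> i. L (d $ inv \<pi> i)) = card {i. \<pi> i = i} * lin_trace L"
proof -
  have B: "Basis = (\<Union>i::'n. axis i ` (Basis::'a set))" by (auto simp: Basis_vec_def)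
  have "lin_trace (\<lambda>d::'a^'n. \<chi> i. L (d $ inv \<pi> i))
      = (\<Sum>i\<in>UNIV. \<Sum>b\<in>axis i ` (Basis::'a set). (\<chi> k. L (b $ inv \<pi> k)) \<bullet> b)"
    unfolding lin_trace_def B
    by (subst sum.UNION_disjoint) (auto simp: axis_eq_axis)
  also have "\<dots> = (\<Sum>i\<in>UNIV. \<Sum>b\<in>Basis. (\<chi> k. L (axis i b $ inv \<pi> k)) \<bullet> axis i b)"
    by (intro sum.cong refl, subst sum.reindex) (auto simp: inj_on_def axis_eq_axis)
  also have "\<dots> = (\<Sum>i\<in>UNIV. \<Sum>b\<in>Basis. if \<pi> i = i then L b \<bullet> b else 0)"
    using assms by (intro sum.cong refl)
      (simp add: inner_axis inv_permutation_eq_self axis_nth, simp add: axis_def inv_permutation_eq_self)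
  also have "\<dots> = (\<Sum>i\<in>UNIV. if \<pi> i = i then lin_trace L else 0)"
    by (intro sum.cong refl) (simp add: lin_trace_def)
  also have "\<dots> = card {i. \<pi> i = i} * lin_trace L"
    by (simp add: sum.If_cases)
  finally show ?thesis .
qed

section \<open>Stresses and rigid motions of an isostatic framework\<close>

locale isostatic_framework =
  fixes ends :: "'b::finite \<Rightarrow> 'j::finite set" and p :: "'j \<Rightarrow> real^3"
  assumes fw: "framework ends p" and more_than_3: "CARD('j) > 3" and iso: "isostatic ends p"
begin

lemma inj_ends: "inj ends" and card_ends: "card (ends e) = 2" and inj_p: "inj p"
  using fw by (auto simp: framework_def)

lemma p_eq_iff [simp]: "p v = p w \<longleftrightarrow> v = w"
  using inj_p by (auto dest: injD)

lemma rank_compat: "rank (compat_matrix ends p) = CARD('b)"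
  using iso by (simp add: isostatic_def self_stresses_def)

lemma card_bars: "int CARD('b) = 3 * int CARD('j) - 6"
  using iso by (simp add: isostatic_def self_stresses_def mechanisms_def)

lemma ends_pair: obtains v w where "ends e = {v, w}" "v \<noteq> w"
  using card_ends[of e] by (auto simp: card_2_iff)

lemma other_end_eq: "ends e = {v, w} \<Longrightarrow> other_end ends e v = w"
  unfolding other_end_def by (rule the_equality) (auto simp: doubleton_eq_iff)

lemma ends_other_end: "v \<in> ends e \<Longrightarrow> ends e = {v, other_end ends e v} \<and> other_end ends e v \<noteq> v"
  by (rule ends_pair[of e]) (metis insert_commute insert_iff other_end_eq singletonD)

text \<open>A row of the matrix cut into one 3-vector per joint: at an end of the bar, the unit
  vector pointing there from the other end. In this form an isometry acts on rows through its linear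
  part.\<close>

definition bar_vec :: "'b \<Rightarrow> 'j \<Rightarrow> real^3" where
  "bar_vec e v = (\<chi> k. compat_matrix ends p $ e $ (v, k))"

lemma bar_vec_eq: "bar_vec e v = (if v \<in> ends e
   then (p v - p (other_end ends e v)) /\<^sub>R norm (p v - p (other_end ends e v)) else 0)"
  by (simp add: bar_vec_def compat_matrix_def vec_eq_iff divide_inverse mult.commute)

lemma bar_vec_sum:
  assumes "ends e = {v, w}" "v \<noteq> w"
  shows "(\<Sum>x\<in>UNIV. bar_vec e x \<bullet> d x) = ((p v - p w) /\<^sub>R norm (p v - p w)) \<bullet> (d v - d w)"
proof -
  have "(\<Sum>x\<in>UNIV. bar_vec e x \<bullet> d x) = (\<Sum>x\<in>{v, w}. bar_vec e x \<bullet> d x)"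
    using assms by (intro sum.mono_neutral_right) (auto simp: bar_vec_eq)
  also have "\<dots> = bar_vec e v \<bullet> d v + bar_vec e w \<bullet> d w" using assms by simp
  also have "bar_vec e v = (p v - p w) /\<^sub>R norm (p v - p w)"
    using assms by (simp add: bar_vec_eq other_end_eq)
  also have "bar_vec e w = - ((p v - p w) /\<^sub>R norm (p v - p w))"
    using assms other_end_eq[of e w v]
    by (simp add: bar_vec_eq insert_commute norm_minus_commute)
      (metis minus_diff_eq scaleR_minus_right)
  finally show ?thesis by (simp add: inner_simps algebra_simps)
qed

lemma not_on_line: 
  assumes "w \<noteq> 0" shows "\<exists>v v'. cross3 w (p v - p v') \<noteq> 0"
proof (rule ccontr)
  assume "\<not> ?thesis"
  then have par: "cross3 w (p v - p v') = 0" for v v' by blast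
  \<comment> \<open>On a line \<open>C\<close> sees only the components along \<open>w\<close>, so its rank is at most \<open>j < 3j - 6\<close>.\<close>
  define A :: "real^'j^'b" where "A = (\<chi> e v. (bar_vec e v \<bullet> w) / (w \<bullet> w))"
  define B :: "real^('j \<times> 3)^'j" where "B = (\<chi> v xk. if fst xk = v then w $ snd xk else 0)"
  \<comment> \<open>The identity \<open>w \<times> (w \<times> y) = (w \<bullet> y) w - (w \<bullet>
    w) y\<close> turns parallelism to \<open>w\<close> into an explicit multiple of
    \<open>w\<close>.\<close>
  have along: "(w \<bullet> w) *\<^sub>R bar_vec e v = (bar_vec e v \<bullet> w) *\<^sub>R w" for e v
  proof -
    have "cross3 w (bar_vec e v) = 0" 
      using par by (simp add: bar_vec_eq cross_mult_right)
    then have "cross3 w (cross3 w (bar_vec e v)) = 0" by simp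
    then show ?thesis 
      by (simp add: Lagrange inner_commute)
  qed
  have "compat_matrix ends p = A ** B"
  proof -
    have "compat_matrix ends p $ e $ (v, k) = (A ** B) $ e $ (v, k)" for e v k
    proof -
      have "(w \<bullet> w) * compat_matrix ends p $ e $ (v, k) = (bar_vec e v \<bullet> w) * w $ k"
        using arg_cong[OF along, of "\<lambda>x. x $ k"] by (simp add: bar_vec_def)
      moreover have "(A ** B) $ e $ (v, k) = A $ e $ v * w $ k"
        by (simp add: matrix_matrix_mult_def B_def if_distrib cong: if_cong)
      moreover have "w \<bullet> w \<noteq> 0" using assms by simp
      moreover have "A $ e $ v = (bar_vec e v \<bullet> w) / (w \<bullet> w)" by (simp add: A_def)
      ultimately show ?thesis by (metis nonzero_eq_divide_eq mult.commute times_divide_eq_left)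
    qed
    then show ?thesis by (simp add: vec_eq_iff)
  qed
  then have "rank (compat_matrix ends p) \<le> rank B"
    using rank_mul_le_right by metis
  also have "\<dots> \<le> CARD('j)" using rank_bound[of B] by simp
  finally show False using rank_compat card_bars more_than_3 by simp
qed

text \<open>The sum over bars is the transpose of \<open>compat_matrix\<close> applied to
  \<open>l\<close>, the resultant force at each joint. The values are indexed by joints so that a
  symmetry acts on them by permuting blocks.\<close>

definition stress_motion :: "(real^'b) \<times> (real^3) \<times> (real^3) \<Rightarrow> real^3^'j" where
  "stress_motion = (\<lambda>(l, a, w). \<chi> v. (\<Sum>e\<in>UNIV. l $ e *\<^sub>R bar_vec e v) + a + cross3 w (p v))"

lemma linear_stress_motion: "linear stress_motion"
  by (rule linearI)
    (auto simp: stress_motion_def vec_eq_iff sum.distrib scaleR_sum_right scaleR_add_left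
      scaleR_add_right cross_add_left cross_mult_left sum_distrib_left algebra_simps)

lemma bij_stress_motion: "bij stress_motion"
proof -
  have "x = 0" if "stress_motion x = 0" for x
  proof -
    obtain l a w where x: "x = (l, a, w)" by (cases x) auto
    define s where "s v = (\<Sum>e\<in>UNIV. l $ e *\<^sub>R bar_vec e v)" for v
    define d where "d v = a + cross3 w (p v)" for v
    have sd: "s v = - d v" for v
    proof -
      have "stress_motion x $ v = s v + d v"
        by (simp add: x stress_motion_def s_def d_def)
      then show ?thesis using that by (simp add: eq_neg_iff_add_eq_0)
    qed
    \<comment> \<open>A rigid motion extends no bar, since \<open>cross3 w y\<close> is orthogonal
      to \<open>y\<close>.\<close>
    have unstretched: "(\<Sum>v\<in>UNIV. bar_vec e v \<bullet> d v) = 0" for e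
    proof (rule ends_pair[of e])
      fix v v' assume "ends e = {v, v'}" "v \<noteq> v'"
      moreover have "d v - d v' = cross3 w (p v - p v')"
        by (simp add: d_def Cross3.right_diff_distrib)
      ultimately show ?thesis by (simp add: bar_vec_sum dot_cross_self)
    qed
    \<comment> \<open>Forces and velocities are opposite and also orthogonal, so both
      vanish.\<close>
    have "(\<Sum>v\<in>UNIV. s v \<bullet> s v) = - (\<Sum>v\<in>UNIV. s v \<bullet> d v)"
      by (simp add: sd sum_negf)
    also have "(\<Sum>v\<in>UNIV. s v \<bullet> d v) = (\<Sum>e\<in>UNIV. l $ e * (\<Sum>v\<in>UNIV. bar_vec e v \<bullet> d v))"
      unfolding s_def inner_sum_left sum_distrib_left by (subst sum.swap) simp
    finally have "(\<Sum>v\<in>UNIV. s v \<bullet> s v) = 0" by (simp add: unstretched)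
    then have s0: "s v = 0" for v
      by (subst (asm) sum_nonneg_eq_0_iff) auto
    have "(transpose (compat_matrix ends p) *v l) $ (v, k) = s v $ k" for v k
      by (simp add: matrix_vector_mult_def transpose_def s_def bar_vec_def mult.commute)
    then have "transpose (compat_matrix ends p) *v l = 0"
      by (simp add: vec_eq_iff s0)
    \<comment> \<open>Independent rows give the transpose full column rank; this is the absence of
      self-stress.\<close>
    moreover have "inj ((*v) (transpose (compat_matrix ends p)))"
      by (simp add: rank_compat rank_transpose flip: full_rank_injective)
    ultimately have "l = 0"
      by (metis injD matrix_vector_mult_0_right)
    have d0: "d v = 0" for v using sd[of v] s0[of v] by simp
    have "cross3 w (p v - p v') = 0" for v v'
      using d0[of v] d0[of v'] by (simp add: d_def Cross3.right_diff_distrib add_eq_0_iff)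
    then have "w = 0" using not_on_line by blast
    moreover have "a = 0" using d0 \<open>w = 0\<close> by (simp add: d_def)
    ultimately show "x = 0" by (simp add: x \<open>l = 0\<close> zero_prod_def)
  qed
  then have inj: "inj stress_motion"
    using linear_stress_motion by (simp add: linear_injective_0)
  \<comment> \<open>The count \<open>b + 6 = 3j\<close> makes the dimensions agree, so injectivity
    yields surjectivity.\<close>
  have "DIM((real^'b) \<times> (real^3) \<times> (real^3)) = DIM(real^3^'j)"
    using card_bars by simp
  then have "surj stress_motion"
    by (intro linear_injective_imp_surjective linear_stress_motion inj) simp
  with inj show ?thesis by (simp add: bij_def)
qed

section \<open>The action of the point group and the counting formula\<close>

lemma isometry_permutes:
  assumes "f \<in> point_group ends p"
  obtains \<pi> \<rho> where "bij \<pi>" "bij \<rho>" "\<And>v. p (\<pi> v) = f (p v)" "\<And>e. ends (\<rho> e) = \<pi> ` ends e"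
proof -
  have f: "isometry f" "f ` range p = range p" "\<And>e. \<exists>e'. f ` p ` ends e = p ` ends e'"
    using assms by (auto simp: point_group_def)
  have inj_f: "inj f"
    using f(1) unfolding isometry_def inj_def by (metis dist_eq_0_iff)
  have "\<exists>w. p w = f (p v)" for v using f(2) by (metis rangeE rangeI imageI)
  then obtain \<pi> where \<pi>: "\<And>v. p (\<pi> v) = f (p v)" by metis
  obtain \<rho> where \<rho>: "\<And>e. f ` p ` ends e = p ` ends (\<rho> e)" using f(3) by metis
  have ends: "ends (\<rho> e) = \<pi> ` ends e" for e
  proof -
    have "p ` ends (\<rho> e) = p ` \<pi> ` ends e" by (simp add: \<pi> image_image flip: \<rho>)
    then show ?thesis using inj_p by (simp add: inj_image_eq_iff)
  qed
  have inj_pi: "inj \<pi>"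
  proof (rule injI)
    fix v w assume "\<pi> v = \<pi> w"
    then have "f (p v) = f (p w)" by (simp flip: \<pi>)
    then show "v = w" using inj_f by (simp add: inj_eq)
  qed
  moreover have "inj \<rho>"
  proof (rule injI)
    fix d e assume "\<rho> d = \<rho> e"
    then have "\<pi> ` ends d = \<pi> ` ends e" by (simp flip: ends)
    then show "d = e" using inj_pi inj_ends by (simp add: inj_image_eq_iff inj_eq)
  qed
  ultimately show ?thesis
    using that[of \<pi> \<rho>] \<pi> ends by (auto simp: bij_def finite_UNIV_inj_surj)
qed

text \<open>Equality of the traces of two actions intertwined by \<open>stress_motion\<close>:
  \<open>P\<close> on joint displacements and \<open>Q\<close> on tensions and rigid
  motions.\<close>

lemma symmetry_count:
  assumes f: "f \<in> point_group ends p" and "f = (\<lambda>x. a + A *v x)" and A: "orthogonal_matrix A"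
  shows "card {v. f (p v) = p v} * trace A
    = card (unshifted_bars ends p f) + trace A * (1 + det A)"
proof -
  obtain \<pi> \<rho> where bij: "bij \<pi>" "bij \<rho>"
    and \<pi>: "\<And>v. p (\<pi> v) = f (p v)" and \<rho>: "\<And>e. ends (\<rho> e) = \<pi> ` ends e"
    using isometry_permutes[OF f] by blast
  have det2: "det A * det A = 1" using det_orthogonal_matrix[OF A] by auto
  have f_eq: "f x = a + A *v x" for x using assms(2) by simp
  have norm_A: "norm (A *v x) = norm x" for x
    using A by (simp add: orthogonal_transformation_matrix orthogonal_transformation_norm
        matrix_vector_mul_linear)
  define P where "P = (\<lambda>d::real^3^'j. \<chi> v. A *v (d $ inv \<pi> v))"
  \<comment> \<open>The motion \<open>x \<mapsto> b + w \<times> x\<close> is transported to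
    \<open>x \<mapsto> A b + det A (A w \<times> (x - a))\<close>: the rotation vector is a
    pseudovector, whence \<open>det A\<close>, and the shift by \<open>a\<close> enters the
    translation part.\<close>
  define Q where "Q = (\<lambda>(l::real^'b, b, w).
    (\<chi> e. l $ inv \<rho> e, A *v b - det A *\<^sub>R cross3 (A *v w) a, det A *\<^sub>R (A *v w)))"
  have bar_vec_image: "bar_vec (\<rho> e) (\<pi> v) = A *v bar_vec e v" for e v
  proof (cases "v \<in> ends e")
    case True
    then have e: "ends e = {v, other_end ends e v}" using ends_other_end by blast
    then have "ends (\<rho> e) = {\<pi> v, \<pi> (other_end ends e v)}" using \<rho> by (metis image_empty image_insert)
    then have "other_end ends (\<rho> e) (\<pi> v) = \<pi> (other_end ends e v)" "\<pi> v \<in> ends (\<rho> e)"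
      using other_end_eq by auto
    then show ?thesis
      using True norm_A[of "p v - p (other_end ends e v)"]
      by (simp add: bar_vec_eq \<pi> f_eq matrix_vector_mult_diff_distrib matrix_vector_mult_scaleR)
  next
    case False
    then have "\<pi> v \<notin> ends (\<rho> e)" using \<rho> bij by (auto simp: bij_def dest: injD)
    with False show ?thesis by (simp add: bar_vec_eq)
  qed
  have cross: "A *v cross3 w x = det A *\<^sub>R cross3 (A *v w) (A *v x)" for w x
    using cross_orthogonal_matrix[OF A, of w x] det2 by simp
  have "P (stress_motion x) = stress_motion (Q x)" for x
  proof -
    obtain l b w where x: "x = (l, b, w)" by (cases x) auto
    \<comment> \<open>At \<open>\<pi> v\<close> the inverse permutation disappears; surjectivity of
      \<open>\<pi>\<close> then covers all joints.\<close>
    have "P (stress_motion x) $ \<pi> v = stress_motion (Q x) $ \<pi> v" for v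
    proof -
      have "P (stress_motion x) $ \<pi> v
          = (\<Sum>e\<in>UNIV. l $ e *\<^sub>R bar_vec (\<rho> e) (\<pi> v)) + A *v b + A *v cross3 w (p v)"
        using bij by (simp add: P_def x stress_motion_def bij_is_inj matrix_vector_right_distrib
            bar_vec_image linear_sum[OF matrix_vector_mul_linear] matrix_vector_mult_scaleR)
      also have "(\<Sum>e\<in>UNIV. l $ e *\<^sub>R bar_vec (\<rho> e) (\<pi> v))
          = (\<Sum>e\<in>UNIV. l $ inv \<rho> e *\<^sub>R bar_vec e (\<pi> v))"
        using bij by (intro sum.reindex_bij_witness[of _ "inv \<rho>" \<rho>])
          (auto simp: bij_is_inj bij_is_surj surj_f_inv_f)
      also have "A *v cross3 w (p v) = cross3 (det A *\<^sub>R (A *v w)) (p (\<pi> v)) - det A *\<^sub>R cross3 (A *v w) a"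
        by (simp add: cross \<pi> f_eq cross_add_right cross_mult_left scaleR_add_right)
      finally show ?thesis by (simp add: stress_motion_def Q_def x)
    qed
    then have "P (stress_motion x) $ v = stress_motion (Q x) $ v" for v
      using bij(1) bij_pointE by metis
    then show ?thesis by (simp add: vec_eq_iff)
  qed
  moreover have "linear Q"
    by (rule linearI) (auto simp: Q_def vec_eq_iff matrix_vector_right_distrib cross_add_left
        matrix_vector_mult_scaleR cross_mult_left algebra_simps)
  ultimately have "lin_trace P = lin_trace Q"
    using lin_trace_intertwine linear_stress_motion bij_stress_motion by blast
  moreover have "lin_trace P = card {v. \<pi> v = v} * trace A"
    unfolding P_def using bij by (subst lin_trace_permute) (auto simp: lin_trace_matrix)
  \<comment> \<open>The term carrying \<open>w\<close> into the translation part lies off the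
    diagonal, so only the three diagonal blocks contribute.\<close>
  moreover have "lin_trace Q = card {e. \<rho> e = e} + trace A + det A * trace A"
  proof -
    have "lin_trace (\<lambda>w. det A *\<^sub>R (A *v w)) = det A * lin_trace ((*v) A)"
      by (simp add: lin_trace_def sum_distrib_left)
    moreover have "lin_trace (\<lambda>l::real^'b. \<chi> e. l $ inv \<rho> e) = card {e. \<rho> e = e}"
      using lin_trace_permute[of \<rho> "\<lambda>x::real. x"] bij by (simp add: lin_trace_def)
    ultimately show ?thesis
      by (simp add: lin_trace_prod Q_def lin_trace_matrix zero_prod_def)
  qed
  moreover have "{v. \<pi> v = v} = {v. f (p v) = p v}"
    by (simp flip: \<pi>)
  moreover have "{e. \<rho> e = e} = unshifted_bars ends p f"
  proof -
    have "\<rho> e = e \<longleftrightarrow> f ` p ` ends e = p ` ends e" for e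
    proof -
      have "f ` p ` ends e = p ` ends (\<rho> e)" by (simp add: \<rho> \<pi> image_image)
      then show ?thesis
        using inj_p inj_ends by (metis inj_image_eq_iff injD)
    qed
    then show ?thesis by (simp add: unshifted_bars_def)
  qed
  ultimately show ?thesis by (simp add: algebra_simps)
qed

end

section \<open>Symmetries with an axis\<close>

text \<open>Multiplication by \<open>z\<close> in the plane orthogonal to the unit vector
  \<open>u\<close>, read as the complex plane, and by \<open>d\<close> along \<open>u\<close>. This
  covers rotations, reflections, improper rotations and the inversion at once; \<open>z\<close> and
  \<open>d\<close> stay arbitrary so that differences of such maps have the same form.\<close>

definition axial_lin :: "real^3 \<Rightarrow> complex \<Rightarrow> real \<Rightarrow> real^3 \<Rightarrow> real^3" where
  "axial_lin u z d x = Re z *\<^sub>R x + Im z *\<^sub>R cross3 u x + ((d - Re z) * (u \<bullet> x)) *\<^sub>R u"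

definition axial :: "real^3 \<Rightarrow> real^3 \<Rightarrow> complex \<Rightarrow> real \<Rightarrow> real^3 \<Rightarrow> real^3" where
  "axial c u z d x = c + axial_lin u z d (x - c)"

lemma rotation_C_eq_axial: "rotation_C n c u = axial c u (cis (2 * pi / real n)) 1"
  by (simp add: fun_eq_iff rotation_C_def axial_def axial_lin_def)

lemma reflection_eq_axial: "reflection c u = axial c u 1 (-1)"
  by (simp add: fun_eq_iff reflection_def axial_def axial_lin_def)

lemma inversion_eq_axial: "inversion c = axial c u (-1) (-1)"
  by (simp add: fun_eq_iff inversion_def axial_def axial_lin_def)

lemma linear_axial_lin: "linear (axial_lin u z d)"
  by (rule linearI) (simp_all add: axial_lin_def cross_add_right cross_mult_right inner_add_right
      algebra_simps)

text \<open>In the plane orthogonal to \<open>u\<close> the map \<open>cross3 u\<close> squares to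
  -1 and so acts as the imaginary unit. Powers of a symmetry thereby become powers of
  \<open>z\<close> and \<open>d\<close>.\<close>

lemma axial_lin_comp:
  assumes "norm u = 1"
  shows "axial_lin u z d (axial_lin u z' d' x) = axial_lin u (z * z') (d * d') x"
proof -
  have [simp]: "u \<bullet> u = 1" using assms by (simp add: norm_eq_1)
  have cross: "cross3 u (axial_lin u z' d' x)
      = Re z' *\<^sub>R cross3 u x + Im z' *\<^sub>R ((u \<bullet> x) *\<^sub>R u - x)"
    by (simp add: axial_lin_def cross_add_right cross_mult_right Lagrange)
  have inner: "u \<bullet> axial_lin u z' d' x = d' * (u \<bullet> x)"
    by (simp add: axial_lin_def inner_add_right dot_cross_self algebra_simps)
  show ?thesis
    unfolding axial_lin_def[of u z d] cross inner
    by (simp add: axial_lin_def algebra_simps)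
qed

lemma axial_comp:
  "norm u = 1 \<Longrightarrow> axial c u z d \<circ> axial c u z' d' = axial c u (z * z') (d * d')"
  by (simp add: fun_eq_iff axial_def axial_lin_comp)

lemma improper_S_eq_axial:
  "norm u = 1 \<Longrightarrow> improper_S n c u = axial c u (cis (2 * pi / real n)) (-1)"
  by (simp add: improper_S_def reflection_eq_axial rotation_C_eq_axial axial_comp)

text \<open>Pythagoras: \<open>x \<bullet> x - (u \<bullet> x)\<^sup>2\<close> is the squared length
  of the component of \<open>x\<close> orthogonal to \<open>u\<close>.\<close>

lemma norm_axial_lin:
  assumes "norm u = 1"
  shows "(norm (axial_lin u z d x))\<^sup>2 = (cmod z)\<^sup>2 * (x \<bullet> x - (u \<bullet> x)\<^sup>2) + d\<^sup>2 * (u \<bullet> x)\<^sup>2"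
proof -
  have u: "u \<bullet> u = 1" using assms by (simp add: norm_eq_1)
  have "cross3 u x \<bullet> cross3 u x = x \<bullet> x - (u \<bullet> x)\<^sup>2"
    using norm_cross_dot[of u x] assms by (simp add: power2_norm_eq_inner)
  then show ?thesis
    unfolding axial_lin_def power2_norm_eq_inner[of "_ + _"] cmod_power2
    by (simp add: inner_add_left inner_add_right dot_cross_self u inner_commute[of x u]
        inner_commute[of x "cross3 u x"])
      (simp add: power2_eq_square algebra_simps)
qed

lemma norm_axial_lin_isometric:
  assumes "norm u = 1" "cmod z = 1" "\<bar>d\<bar> = 1"
  shows "norm (axial_lin u z d x) = norm x"
proof -
  have "d\<^sup>2 = 1" using assms(3) by (metis power2_abs one_power2)
  then have "(norm (axial_lin u z d x))\<^sup>2 = (norm x)\<^sup>2"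
    unfolding norm_axial_lin[OF assms(1)] assms(2) by (simp add: power2_norm_eq_inner)
  then show ?thesis by simp
qed

lemma axial_eq_matrix: "axial c u z d = (\<lambda>x. (c - axial_lin u z d c) + matrix (axial_lin u z d) *v x)"
  by (simp add: fun_eq_iff axial_def linear_diff[OF linear_axial_lin] matrix_works
      linear_axial_lin)

text \<open>The sum of the eigenvalues \<open>z\<close>, \<open>cnj z\<close> and \<open>d\<close>,
  obtained in coordinates.\<close>

lemma trace_axial_lin: "norm u = 1 \<Longrightarrow> trace (matrix (axial_lin u z d)) = 2 * Re z + d"
proof -
  assume "norm u = 1"
  then have "u $ 1 * u $ 1 + u $ 2 * u $ 2 + u $ 3 * u $ 3 = 1"
    by (simp add: norm_eq_1 inner_vec_def sum_3)
  moreover have "trace (matrix (axial_lin u z d)) =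
      3 * Re z + (d - Re z) * (u $ 1 * u $ 1 + u $ 2 * u $ 2 + u $ 3 * u $ 3)"
    by (simp add: trace_def sum_3 matrix_def axial_lin_def axis_def cross3_def inner_vec_def
        algebra_simps)
  ultimately show ?thesis by simp
qed

lemma det_axial_lin: "norm u = 1 \<Longrightarrow> det (matrix (axial_lin u z d)) = (cmod z)\<^sup>2 * d"
proof -
  assume "norm u = 1"
  then have u: "u $ 1 * u $ 1 + u $ 2 * u $ 2 + u $ 3 * u $ 3 = 1"
    by (simp add: norm_eq_1 inner_vec_def sum_3)
  define a b x y w where "a = Re z" and "b = Im z" and "x = u $ 1" and "y = u $ 2" and "w = u $ 3"
  note defs = this
  have "det (matrix (axial_lin u z d)) =
     (a + (d - a) * x * x) * (a + (d - a) * y * y) * (a + (d - a) * w * w)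
   + ((d - a) * x * y - b * w) * ((d - a) * y * w - b * x) * ((d - a) * x * w - b * y)
   + ((d - a) * x * w + b * y) * ((d - a) * x * y + b * w) * ((d - a) * y * w + b * x)
   - (a + (d - a) * x * x) * ((d - a) * y * w - b * x) * ((d - a) * y * w + b * x)
   - ((d - a) * x * y - b * w) * ((d - a) * x * y + b * w) * (a + (d - a) * w * w)
   - ((d - a) * x * w + b * y) * (a + (d - a) * y * y) * ((d - a) * x * w - b * y)"
    unfolding det_3 defs
    by (simp add: matrix_def axial_lin_def axis_def cross3_def inner_vec_def sum_3 algebra_simps)
  \<comment> \<open>Grouping by powers of the squared length of \<open>u\<close> lets it be replaced
    by 1.\<close>
  also have "\<dots> = a * a * a + (a * a * (d - a) + a * b * b) * (x * x + y * y + w * w)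
      + b * b * (d - a) * (x * x + y * y + w * w) * (x * x + y * y + w * w)"
    by algebra
  also have "\<dots> = (a * a + b * b) * d"
    unfolding u[folded defs] by algebra
  finally show ?thesis unfolding cmod_power2 by (simp add: power2_eq_square defs)
qed

lemma orthogonal_matrix_axial_lin:
  assumes "norm u = 1" "cmod z = 1" "\<bar>d\<bar> = 1"
  shows "orthogonal_matrix (matrix (axial_lin u z d))"
  using norm_axial_lin_isometric[OF assms] linear_axial_lin
    orthogonal_transformation orthogonal_transformation_matrix by blast

text \<open>The equality case of Cauchy-Schwarz, phrased with the quantity that
  \<open>norm_axial_lin\<close> produces.\<close>

lemma axis_line_iff:
  assumes "norm u = 1"
  shows "x \<in> axis_line c u \<longleftrightarrow> (x - c) \<bullet> (x - c) = (u \<bullet> (x - c))\<^sup>2"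
proof -
  have u: "u \<bullet> u = 1" using assms by (simp add: norm_eq_1)
  define y where "y = x - c"
  have "x \<in> axis_line c u \<longleftrightarrow> y = (u \<bullet> y) *\<^sub>R u"
  proof
    assume "y = (u \<bullet> y) *\<^sub>R u"
    then have "x = c + (u \<bullet> y) *\<^sub>R u" by (simp add: y_def algebra_simps)
    then show "x \<in> axis_line c u" by (auto simp: axis_line_def)
  qed (auto simp: axis_line_def y_def u)
  also have "\<dots> \<longleftrightarrow> (y - (u \<bullet> y) *\<^sub>R u) \<bullet> (y - (u \<bullet> y) *\<^sub>R u) = 0" by simp
  also have "(y - (u \<bullet> y) *\<^sub>R u) \<bullet> (y - (u \<bullet> y) *\<^sub>R u) = y \<bullet> y - (u \<bullet> y)\<^sup>2"
    by (simp add: inner_diff_left inner_diff_right u inner_commute[of y u] power2_eq_square)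
  finally show ?thesis by (simp add: y_def)
qed

text \<open>The displacement of \<open>x\<close> is \<open>axial_lin u (z - 1) (d - 1)\<close> of
  \<open>x - c\<close>, and its squared norm is a sum of two nonnegative terms that must vanish
  separately.\<close>

lemma axial_fixed_iff:
  assumes "norm u = 1"
  shows "axial c u z d x = x \<longleftrightarrow>
    (z = 1 \<or> x \<in> axis_line c u) \<and> (d = 1 \<or> x \<in> perp_plane c u)"
proof -
  define y where "y = x - c"
  have "axial c u z d x - x = axial_lin u (z - 1) (d - 1) y"
    by (simp add: axial_def axial_lin_def y_def algebra_simps)
  then have "axial c u z d x = x \<longleftrightarrow> (norm (axial_lin u (z - 1) (d - 1) y))\<^sup>2 = 0"
    by (metis eq_iff_diff_eq_0 norm_eq_zero zero_eq_power2)
  also have "\<dots> \<longleftrightarrow>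
      (cmod (z - 1))\<^sup>2 * (y \<bullet> y - (u \<bullet> y)\<^sup>2) = 0 \<and> (d - 1)\<^sup>2 * (u \<bullet> y)\<^sup>2 = 0"
  proof -
    have "(u \<bullet> y)\<^sup>2 \<le> y \<bullet> y"
      using Cauchy_Schwarz_ineq[of u y] assms by (simp add: norm_eq_1)
    then show ?thesis
      unfolding norm_axial_lin[OF assms] by (intro add_nonneg_eq_0_iff) auto
  qed
  finally show ?thesis
    using axis_line_iff[OF assms, of x c] by (auto simp: y_def perp_plane_def)
qed

lemma axis_line_Int_perp_plane: "norm u = 1 \<Longrightarrow> axis_line c u \<inter> perp_plane c u = {c}"
  by (auto simp: axis_line_def perp_plane_def norm_eq_1)

lemma point_group_comp:
  assumes "f \<in> point_group ends p" "g \<in> point_group ends p"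
  shows "f \<circ> g \<in> point_group ends p"
proof -
  have "(f \<circ> g) ` range p = range p" "\<exists>e'. (f \<circ> g) ` p ` ends e = p ` ends e'" for e
    using assms unfolding point_group_def mem_Collect_eq image_comp[symmetric] by metis+
  then show ?thesis using assms by (simp add: point_group_def isometry_def)
qed

section \<open>Counts of unshifted joints and bars for each type of symmetry\<close>

context isostatic_framework begin

lemma symmetry_count_axial:
  assumes "norm u = 1" "cmod z = 1" "\<bar>d\<bar> = 1" "axial c u z d \<in> point_group ends p"
  shows "card {v. axial c u z d (p v) = p v} * (2 * Re z + d)
    = card (unshifted_bars ends p (axial c u z d)) + (2 * Re z + d) * (1 + d)"
  using symmetry_count[OF assms(4) axial_eq_matrix orthogonal_matrix_axial_lin[OF assms(1-3)]]
  by (simp add: trace_axial_lin det_axial_lin assms(1,2))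

lemma count_rotation:
  assumes "norm u = 1" "cmod z = 1" "z \<noteq> 1" "axial c u z 1 \<in> point_group ends p"
  shows "(real (card (joints_in p (axis_line c u))) - 2) * (2 * Re z + 1)
    = card (unshifted_bars ends p (axial c u z 1))"
  using symmetry_count_axial[OF assms(1,2) _ assms(4)] assms(1,3)
  by (simp add: axial_fixed_iff joints_in_def algebra_simps)

lemma count_reflection:
  assumes "norm u = 1" "axial c u 1 (-1) \<in> point_group ends p"
  shows "card (joints_in p (perp_plane c u)) = card (unshifted_bars ends p (axial c u 1 (-1)))"
  using symmetry_count_axial[OF assms(1) _ _ assms(2)] assms(1)
  by (simp add: axial_fixed_iff joints_in_def)

text \<open>With \<open>d = -1\<close> the rigid-motion term \<open>1 + d\<close> vanishes, and the
  only fixed point is the centre, where axis and plane meet.\<close>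

lemma count_improper:
  assumes "norm u = 1" "cmod z = 1" "z \<noteq> 1" "axial c u z (-1) \<in> point_group ends p"
  shows "card (joints_in p {c}) * (2 * Re z - 1) = card (unshifted_bars ends p (axial c u z (-1)))"
proof -
  have "{v. axial c u z (-1) (p v) = p v} = joints_in p {c}"
    using axis_line_Int_perp_plane[OF assms(1), of c] assms(1,3)
    by (auto simp: axial_fixed_iff joints_in_def)
  then show ?thesis
    using symmetry_count_axial[OF assms(1,2) _ assms(4)] by simp
qed

lemma card_joints_in_point: "card (joints_in p {c}) \<le> 1"
  unfolding One_nat_def by (subst card_le_Suc0_iff_eq) (auto simp: joints_in_def)

text \<open>The trace is -3, so a nonpositive number equals a bar count and both are 0.\<close>

lemma no_centre_inversion:
  assumes "norm u = 1" "axial c u (-1) (-1) \<in> point_group ends p"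
  shows "card (joints_in p {c}) = 0" "card (unshifted_bars ends p (axial c u (-1) (-1))) = 0"
proof -
  have "real (card (joints_in p {c})) * - 3 = card (unshifted_bars ends p (axial c u (-1) (-1)))"
    using count_improper[OF assms(1) _ _ assms(2)] by simp
  then show "card (joints_in p {c}) = 0" "card (unshifted_bars ends p (axial c u (-1) (-1))) = 0"
    by linarith+
qed

text \<open>A joint at the centre would make \<open>2 * Re z - 1\<close> a bar count. Being below 1
  it is 0, and the remaining case \<open>Re z = 1 / 2\<close> reduces to the inversion.\<close>

lemma no_centre_improper:
  assumes u: "norm u = 1" and z: "cmod z = 1" "z \<noteq> 1" and f: "axial c u z (-1) \<in> point_group ends p"
  shows "card (joints_in p {c}) = 0 \<and> card (unshifted_bars ends p (axial c u z (-1))) = 0"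
proof -
  have count: "card (joints_in p {c}) * (2 * Re z - 1) = card (unshifted_bars ends p (axial c u z (-1)))"
    by (rule count_improper[OF u z f])
  have "card (joints_in p {c}) \<noteq> 1"
  proof
    assume one: "card (joints_in p {c}) = 1"
    have "Re z < 1"
    proof (rule ccontr)
      assume "\<not> Re z < 1"
      then have "Re z = 1" using complex_Re_le_cmod[of z] z(1) by simp
      then have "Im z = 0" using cmod_power2[of z] z(1) by simp
      with \<open>Re z = 1\<close> z(2) show False by (simp add: complex_eq_iff)
    qed
    moreover have card: "2 * Re z - 1 = card (unshifted_bars ends p (axial c u z (-1)))"
      using count one by simp
    ultimately have "real (card (unshifted_bars ends p (axial c u z (-1)))) < 1"
      by linarith
    then have "real (card (unshifted_bars ends p (axial c u z (-1)))) = 0"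
      by (metis less_one of_nat_0 of_nat_1 of_nat_less_iff)
    then have re: "Re z = 1 / 2" using card by linarith
    \<comment> \<open>So \<open>z\<close> is a primitive sixth root of unity, and the cube of the operation is the inversion.\<close>
    have "z + cnj z = 1" using complex_add_cnj[of z] re by simp
    moreover have "z * cnj z = 1" using complex_norm_square[of z] z by simp
    ultimately have "z * (z * z) = -1" by algebra
    then have "axial c u (-1) (-1) = axial c u z (-1) \<circ> (axial c u z (-1) \<circ> axial c u z (-1))"
      by (simp add: axial_comp u)
    then have "axial c u (-1) (-1) \<in> point_group ends p"
      using f by (simp add: point_group_comp)
    from no_centre_inversion(1)[OF u this] one show False by simp
  qed
  then have "card (joints_in p {c}) = 0" using card_joints_in_point[of c] by linarith
  with count show ?thesis by simp
qed

lemma unshifted_ends: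
  assumes "e \<in> unshifted_bars ends p f" "ends e = {v, w}"
  shows "f (p v) = p v \<and> f (p w) = p w \<or> f (p v) = p w \<and> f (p w) = p v"
  using assms by (auto simp: unshifted_bars_def doubleton_eq_iff)

lemma fixed_bar_unshifted:
  assumes "\<And>x. x \<in> p ` ends e \<Longrightarrow> f x = x"
  shows "e \<in> unshifted_bars ends p f"
proof -
  have "f ` p ` ends e = (\<lambda>x. x) ` p ` ends e" by (rule image_cong) (use assms in auto)
  then show ?thesis by (simp add: unshifted_bars_def)
qed

text \<open>Even if the ends of an unshifted bar are swapped, the square fixes them, and for
  \<open>z * z \<noteq> 1\<close> the square fixes only axis points. The criterion no longer
  mentions \<open>z\<close>, so rotations about one axis can be compared.\<close>

lemma unshifted_rotation_iff:
  assumes u: "norm u = 1" and z: "z * z \<noteq> 1"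
  shows "e \<in> unshifted_bars ends p (axial c u z 1) \<longleftrightarrow> p ` ends e \<subseteq> axis_line c u"
proof -
  obtain v w where e: "ends e = {v, w}" by (rule ends_pair)
  have z1: "z \<noteq> 1" using z by auto
  show ?thesis
  proof
    assume "e \<in> unshifted_bars ends p (axial c u z 1)"
    note swap = unshifted_ends[OF this e]
    have "(axial c u z 1 \<circ> axial c u z 1) x = x" if "x \<in> p ` ends e" for x
      using swap that e by auto
    then show "p ` ends e \<subseteq> axis_line c u"
      by (auto simp: axial_comp u axial_fixed_iff z)
  next
    assume "p ` ends e \<subseteq> axis_line c u"
    then show "e \<in> unshifted_bars ends p (axial c u z 1)"
      by (intro fixed_bar_unshifted) (auto simp: axial_fixed_iff u)
  qed
qed

text \<open>The trace -1 turns the rotation count into a total of 2, from which the position of the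
  bars follows.\<close>

lemma half_turn:
  assumes u: "norm u = 1" and f: "axial c u (-1) 1 \<in> point_group ends p"
  defines "U \<equiv> unshifted_bars ends p (axial c u (-1) 1)"
  shows "card (joints_in p (axis_line c u)) + card U = 2"
    and "e \<in> U \<Longrightarrow> v \<in> ends e \<Longrightarrow> w \<in> ends e \<Longrightarrow> orthogonal u (p v - p w)"
    and "\<not> p ` ends e \<subseteq> axis_line c u"
proof -
  show count: "card (joints_in p (axis_line c u)) + card U = 2"
    using count_rotation[OF u _ _ f] by (simp add: U_def)
  show off_axis: "\<not> p ` ends e \<subseteq> axis_line c u" for e
  proof
    assume on: "p ` ends e \<subseteq> axis_line c u"
    then have "e \<in> U"
      unfolding U_def by (intro fixed_bar_unshifted) (auto simp: axial_fixed_iff u)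
    \<comment> \<open>A bar on the axis would count itself and both its ends, at least three in a
      total of two.\<close>
    then have "card U > 0" by (auto simp: card_gt_0_iff)
    moreover have "card (ends e) \<le> card (joints_in p (axis_line c u))"
      using on by (intro card_mono) (auto simp: joints_in_def)
    ultimately show False using count card_ends[of e] by linarith
  qed
  show "orthogonal u (p v - p w)" if "e \<in> U" "v \<in> ends e" "w \<in> ends e"
  proof (cases "v = w")
    case False
    then have e: "ends e = {v, w}"
      using that(2,3) ends_pair[of e] by (metis doubleton_eq_iff insert_iff singletonD)
    \<comment> \<open>If the ends were fixed instead of swapped, the bar would lie on the axis. Once
      swapped, they differ by twice the component of \<open>p v - c\<close> orthogonal to
      \<open>u\<close>.\<close>
    have "axial c u (-1) 1 (p v) = p w"
      using unshifted_ends[OF that(1)[unfolded U_def] e] off_axis[of e]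
      by (auto simp: axial_fixed_iff u e)
    then have "p v - p w = 2 *\<^sub>R (p v - c) - (2 * (u \<bullet> (p v - c))) *\<^sub>R u"
      by (simp add: axial_def axial_lin_def scaleR_2 algebra_simps flip: \<open>axial c u (-1) 1 (p v) = p w\<close>)
    then show ?thesis
      using u by (simp add: orthogonal_def norm_eq_1 inner_diff_right inner_scaleR_right)
  qed (simp add: orthogonal_def)
qed

lemma rotation_order_gt_2:
  assumes n: "n > 2" and u: "norm u = 1" and f: "rotation_C n c u \<in> point_group ends p"
  shows "card (unshifted_bars ends p (rotation_C n c u)) = 0
    \<and> (n \<noteq> 3 \<longrightarrow> card (joints_in p (axis_line c u)) = 2)"
proof -
  define t where "t = 2 * pi / real n"
  define z where "z = cis t"
  let ?j = "real (card (joints_in p (axis_line c u)))"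
  have t: "0 < t" "t < pi" using n by (auto simp: t_def field_simps)
  then have sin: "sin t > 0" by (rule sin_gt_zero)
  have z: "cmod z = 1" "z \<noteq> 1" "z * z \<noteq> 1"
  proof -
    have "Im z \<noteq> 0" using sin by (simp add: z_def)
    then show "z \<noteq> 1" by auto
    show "z * z \<noteq> 1"
    proof
      assume "z * z = 1"
      then have "z = 1 \<or> z = -1" by (simp add: square_eq_1_iff)
      then show False using \<open>Im z \<noteq> 0\<close> by auto
    qed
  qed (simp add: z_def)
  have f': "axial c u z 1 \<in> point_group ends p"
    using f by (simp add: rotation_C_eq_axial z_def t_def)
  have count: "(?j - 2) * (2 * cos t + 1) = card (unshifted_bars ends p (rotation_C n c u))"
    using count_rotation[OF u z(1,2) f'] by (simp add: z_def t_def rotation_C_eq_axial)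
  have f2: "axial c u (z * z) 1 \<in> point_group ends p"
    using point_group_comp[OF f' f'] by (simp add: axial_comp u)
  consider "n = 3" | "n = 4" | "n > 4" using n by linarith
  then show ?thesis
  proof cases
    case 1
    \<comment> \<open>The trace is 0: the count forbids unshifted bars and says nothing about joints
      on the axis.\<close>
    then have "cos t = - 1 / 2" by (simp add: t_def cos_120)
    with count 1 show ?thesis by simp
  next
    case 2
    then have "z = \<i>" by (simp add: z_def t_def cis_pi_half)
    \<comment> \<open>The square is a half-turn about the same axis, along which no bar
      lies.\<close>
    then have half: "axial c u (-1) 1 \<in> point_group ends p" using f2 by simp
    have "unshifted_bars ends p (rotation_C n c u) = {}"
      using unshifted_rotation_iff[OF u z(3)] half_turn(3)[OF u half]
      by (auto simp: rotation_C_eq_axial z_def t_def)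
    moreover have "cos t = 0" using \<open>z = \<i>\<close> by (simp add: z_def complex_eq_iff)
    ultimately show ?thesis using count by simp
  next
    case 3
    then have "t < pi / 2" using n by (auto simp: t_def field_simps)
    then have cos: "0 < cos t" "cos t < 1"
      using t cos_gt_zero_pi[of t] cos_monotone_0_pi[of 0 t] by auto
    \<comment> \<open>Otherwise \<open>z * z = -1\<close> would be real, but its imaginary part is
      \<open>2 * sin t * cos t > 0\<close>. This makes \<open>unshifted_rotation_iff\<close>
      applicable to the square as well.\<close>
    have z4: "(z * z) * (z * z) \<noteq> 1"
    proof
      assume "(z * z) * (z * z) = 1"
      then have "z * z = -1" using z(3) by (simp add: square_eq_1_iff)
      then have "Im (z * z) = 0" by simp
      then show False using sin cos by (simp add: z_def)
    qed
    \<comment> \<open>The rotation and its square have the same unshifted joints and bars, but different traces.\<close>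
    have "(?j - 2) * (2 * Re (z * z) + 1) = card (unshifted_bars ends p (axial c u (z * z) 1))"
      using count_rotation[OF u _ z(3) f2] z(1) by (simp add: norm_mult)
    also have "unshifted_bars ends p (axial c u (z * z) 1) = unshifted_bars ends p (axial c u z 1)"
      using unshifted_rotation_iff[OF u z4] unshifted_rotation_iff[OF u z(3)] by blast
    also have "real (card \<dots>) = (?j - 2) * (2 * Re z + 1)"
      using count_rotation[OF u z(1,2) f'] by simp
    finally have "(?j - 2) * (Re (z * z) - Re z) = 0" by (simp add: algebra_simps)
    moreover have "Re (z * z) - Re z \<noteq> 0"
    proof -
      have "Re (z * z) - Re z = (2 * cos t + 1) * (cos t - 1)"
        using sin_cos_squared_add3[of t] by (simp add: z_def algebra_simps)
      then show ?thesis using cos by simp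
    qed
    ultimately have "?j = 2" by simp
    with count show ?thesis by simp
  qed
qed

end

section \<open>Orbits of vertices\<close>

lemma isometryE:
  assumes "isometry f"
  obtains a A where "orthogonal_matrix A" "f = (\<lambda>x. a + A *v x)"
proof -
  define g where "g x = f x - f 0" for x
  have g: "orthogonal_transformation g"
    using assms by (simp add: orthogonal_transformation_isometry isometry_def g_def dist_norm)
  then have "orthogonal_matrix (matrix g)" "\<And>x. matrix g *v x = g x"
    by (auto simp: orthogonal_transformation_matrix matrix_works)
  then show ?thesis
    by (intro that[of "matrix g" "f 0"]) (auto simp: g_def)
qed

lemma isometry_orthogonal_matrix:
  assumes "orthogonal_matrix A" shows "isometry (\<lambda>x. a + A *v x)"
proof -
  have "orthogonal_transformation ((*v) A)"
    using assms by (simp add: orthogonal_transformation_matrix matrix_vector_mul_linear)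
  then show ?thesis by (simp add: orthogonal_transformation_isometry isometry_def)
qed

lemma isometry_bij: "isometry f \<Longrightarrow> bij f"
proof -
  assume "isometry f"
  then obtain a A where A: "orthogonal_matrix A" "f = (\<lambda>x. a + A *v x)" by (rule isometryE)
  have "orthogonal_transformation ((*v) A)"
    using A by (simp add: orthogonal_transformation_matrix matrix_vector_mul_linear)
  then have "bij ((*v) A)" by (rule orthogonal_transformation_bij)
  moreover have "bij (\<lambda>x. a + x)" by (rule o_bij[of "\<lambda>x. x - a"]) auto
  ultimately show ?thesis using bij_comp[of "(*v) A" "\<lambda>x. a + x"] by (simp add: A o_def)
qed

text \<open>Membership only asks that bars go to bars; by finiteness the induced map
  \<open>\<rho>\<close> on bars is a bijection, and its inverse serves \<open>inv f\<close>.\<close>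

lemma (in isostatic_framework) point_group_inv:
  assumes "f \<in> point_group ends p" shows "inv f \<in> point_group ends p"
proof -
  have f: "isometry f" "f ` range p = range p" using assms by (auto simp: point_group_def)
  then have bij: "bij f" using isometry_bij by blast
  obtain \<pi> \<rho> where \<pi>: "bij \<rho>" "\<And>v. p (\<pi> v) = f (p v)" "\<And>e. ends (\<rho> e) = \<pi> ` ends e"
    using isometry_permutes[OF assms] by metis
  have "inv f ` p ` ends e = p ` ends (inv \<rho> e)" for e
  proof -
    have "p ` ends e = f ` p ` ends (inv \<rho> e)"
      using \<pi>(3)[of "inv \<rho> e"] \<pi>(1,2) by (simp add: image_image bij_is_surj surj_f_inv_f)
    then show ?thesis by (simp add: image_inv_f_f bij bij_is_inj)
  qed
  moreover have "inv f ` range p = range p"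
    using f(2) image_inv_f_f[OF bij_is_inj[OF bij], of "range p"] by simp
  moreover have "isometry (inv f)"
    using f(1) bij unfolding isometry_def by (metis bij_is_surj surj_f_inv_f)
  ultimately show ?thesis by (auto simp: point_group_def)
qed

lemma axis_line_scale:
  assumes "k \<noteq> 0" shows "axis_line c (k *\<^sub>R w) = axis_line c w"
proof -
  have "c + t *\<^sub>R w = c + (t / k) *\<^sub>R (k *\<^sub>R w)" for t using assms by simp
  then have "axis_line c w \<subseteq> axis_line c (k *\<^sub>R w)" unfolding axis_line_def by blast
  moreover have "axis_line c (k *\<^sub>R w) \<subseteq> axis_line c w" by (auto simp: axis_line_def)
  ultimately show ?thesis by blast
qed

text \<open>The powers of the rotation act freely off the axis, since
  \<open>z ^ k \<noteq> 1\<close> for \<open>0 < k < n\<close>; the points off the axis thus split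
  into orbits of size \<open>n\<close>.\<close>

lemma dvd_card_off_axis:
  assumes u: "norm u = 1" and "n > 0" and X: "finite X" "rotation_C n c u ` X \<subseteq> X"
  shows "n dvd card (X - axis_line c u)"
proof -
  define z where "z = cis (2 * pi / real n)"
  have g_eq: "rotation_C n c u = axial c u z 1" by (simp add: z_def rotation_C_eq_axial)
  define r where "r k = axial c u (z ^ k) 1" for k
  have zn: "z ^ n = 1" using \<open>n > 0\<close> by (simp add: z_def Complex.DeMoivre)
  have z_neq: "z ^ k \<noteq> 1" if "0 < k" "k < n" for k
  proof
    assume "z ^ k = 1"
    then have "cis (2 * pi * real k / real n) = cis (2 * pi * real 0 / real n)"
      by (simp add: z_def Complex.DeMoivre mult.commute)
    moreover have "inj_on (\<lambda>k. cis (2 * pi * real k / real n)) {..<n}"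
      using Complex.bij_betw_roots_unity[OF \<open>n > 0\<close>] by (simp add: bij_betw_def)
    ultimately show False using that by (auto dest: inj_onD[of _ _ k 0])
  qed
  have r_r: "r i (r j x) = r (i + j) x" for i j x
    using axial_comp[OF u] by (simp add: r_def power_add fun_eq_iff)
  have r_n: "r n x = x" for x by (simp add: r_def zn axial_fixed_iff u)
  have r_mod: "r k x = r (k mod n) x" for k x
  proof -
    have "z ^ k = z ^ (n * (k div n) + k mod n)" by simp
    also have "\<dots> = z ^ (k mod n)" using zn by (simp only: power_add power_mult) simp
    finally show ?thesis by (simp add: r_def)
  qed
  have r_X: "r k x \<in> X" if "x \<in> X" for k x
  proof (induction k)
    case 0
    have "r 0 x = x" by (simp add: r_def axial_fixed_iff u)
    then show ?case using that by simp
  next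
    case (Suc k)
    have "r (Suc k) x = rotation_C n c u (r k x)" using r_r[of 1 k x] by (simp add: r_def g_eq)
    then show ?case using Suc X(2) by auto
  qed
  have on_axis: "r k x \<in> axis_line c u \<longleftrightarrow> x \<in> axis_line c u" for k x
  proof -
    have "r k x = x" if "x \<in> axis_line c u" for k x
      using that by (simp add: r_def axial_fixed_iff u)
    \<comment> \<open>The exponent \<open>n * k - k\<close> inverts \<open>r k\<close> without
      negative powers: the exponents add up to a multiple of \<open>n\<close>.\<close>
    moreover have "r (n * k - k) (r k x) = x" 
      using \<open>n > 0\<close> zn by (simp add: r_r) (simp add: r_def power_mult axial_fixed_iff u)
    ultimately show ?thesis by metis
  qed
  define Y where "Y = X - axis_line c u"
  define O' where "O' x = (\<lambda>k. r k x) ` {..<n}" for x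
  \<comment> \<open>Exponents below \<open>n\<close> serve to count an orbit, arbitrary exponents to
    show it is closed.\<close>
  have O_range: "O' x = range (\<lambda>k. r k x)" for x
    unfolding O'_def using r_mod \<open>n > 0\<close> by (auto intro!: image_eqI[of _ _ "_ mod n"])
  have card_O: "card (O' x) = n" if "x \<in> Y" for x
  proof -
    have "inj_on (\<lambda>k. r k x) {..<n}"
    proof (rule linorder_inj_onI)
      fix i j assume ij: "i < j" "i \<in> {..<n}" "j \<in> {..<n}"
      show "r i x \<noteq> r j x"
      proof
        assume "r i x = r j x"
        moreover have "r (j - i) (r i x) = r j x" using ij r_r[of "j - i" i x] by simp
        ultimately have "r (j - i) (r i x) = r i x" by simp
        then have "r i x \<in> axis_line c u"
          using z_neq[of "j - i"] ij by (simp add: r_def[of "j - i"] axial_fixed_iff u)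
        then show False using on_axis that by (simp add: Y_def)
      qed
    qed auto
    then show ?thesis by (simp add: O'_def card_image)
  qed
  have O_sub: "O' y \<subseteq> O' x" if "y \<in> O' x" for x y
    using that by (auto simp: O_range r_r)
  have O_sym: "x \<in> O' y" if y: "y \<in> O' x" for x y
  proof -
    obtain k where "k < n" "y = r k x" using y by (auto simp: O'_def)
    then have "x = r (n - k) y" by (simp add: r_r r_n)
    then show ?thesis by (auto simp: O_range)
  qed
  have O_disj: "O' x \<inter> O' y = {}" if "O' x \<noteq> O' y" for x y
  proof (rule ccontr)
    assume "O' x \<inter> O' y \<noteq> {}"
    then obtain w where "w \<in> O' x" "w \<in> O' y" by blast
    then have "O' w = O' x" "O' w = O' y" using O_sub O_sym by (meson subset_antisym)+
    then show False using that by simp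
  qed
  have "r 0 x = x" for x by (simp add: r_def axial_fixed_iff u)
  then have "x \<in> O' x" for x unfolding O_range by (metis rangeI)
  moreover have "O' x \<subseteq> Y" if "x \<in> Y" for x
    using that r_X on_axis by (auto simp: O_range Y_def)
  ultimately have Un: "\<Union> (O' ` Y) = Y" by blast
  have "n dvd card (\<Union> (O' ` Y))"
    by (rule dvd_partition) (use Un X(1) card_O O_disj in \<open>auto simp: Y_def\<close>)
  then show ?thesis by (simp add: Un) (simp add: Y_def)
qed

section \<open>Symmetries of a similar copy of a centrally symmetric point set\<close>

locale similar_copy =
  fixes W V :: "(real^3) set" and c :: "real^3" and r :: real and Q :: "real^3^3"
  assumes finite_W: "finite W" and W_sym: "\<And>w. w \<in> W \<Longrightarrow> - w \<in> W" and W_ne: "W \<noteq> {}"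
    and r: "r > 0" and Q: "orthogonal_matrix Q" and V: "V = (\<lambda>x. c + r *\<^sub>R (Q *v x)) ` W"
begin

definition \<phi> :: "real^3 \<Rightarrow> real^3" where
  "\<phi> x = c + r *\<^sub>R (Q *v x)"

lemma V_eq: "V = \<phi> ` W"
  by (simp add: V \<phi>_def[abs_def])

lemma Q_inv: "Q *v (transpose Q *v x) = x" "transpose Q *v (Q *v x) = x"
  using Q by (simp_all add: matrix_vector_mul_assoc orthogonal_matrix_def del: transpose_matrix_vector)

lemma surj_phi: obtains y where "x = \<phi> y"
proof -
  have "x = \<phi> (transpose Q *v ((1 / r) *\<^sub>R (x - c)))"
    using r by (simp add: \<phi>_def Q_inv del: transpose_matrix_vector)
  then show ?thesis by (rule that)
qed

lemma inj_phi: "inj \<phi>"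
  using r by (auto intro!: injI simp: \<phi>_def) (metis Q_inv(2))

text \<open>The scale \<open>r\<close> cancels in the conjugate of \<open>M\<close> by
  \<open>\<phi>\<close>. Its linear part \<open>Q M Q\<^sup>T\<close> has the determinant of
  \<open>M\<close>, even when \<open>Q\<close> itself is improper.\<close>

lemma conjugate_rotation:
  assumes M: "rotation_matrix M" "(*v) M ` W \<subseteq> W" and h: "\<And>x. h (\<phi> x) = \<phi> (M *v x)"
  shows "h \<in> rotation_group V"
proof -
  define N where "N = Q ** M ** transpose Q"
  have N: "rotation_matrix N"
    using M Q unfolding N_def rotation_matrix_def
    by (simp add: orthogonal_matrix_mul det_mul orthogonal_matrix_transpose det_transpose)
      (metis det_orthogonal_matrix mult_1 mult_minus1 minus_minus)
  have "h x = (c - N *v c) + N *v x" for x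
  proof -
    obtain y where x: "x = \<phi> y" by (rule surj_phi)
    have "N *v (Q *v y) = Q *v (M *v y)"
      by (simp add: N_def Q_inv flip: matrix_vector_mul_assoc del: transpose_matrix_vector)
    then have "c + N *v (x - c) = h x"
      by (simp add: x h) (simp add: \<phi>_def matrix_vector_mult_scaleR)
    then show ?thesis by (simp add: matrix_vector_mult_diff_distrib algebra_simps)
  qed
  then have "proper_isometry h" using N by (auto simp: proper_isometry_def)
  \<comment> \<open>An injective self-map of a finite set is onto.\<close>
  moreover have "(*v) M ` W = W"
  proof (rule endo_inj_surj[OF finite_W M(2)])
    have "transpose M ** M = mat 1" using M by (simp add: rotation_matrix_def orthogonal_matrix)
    then show "inj_on ((*v) M) W"
      by (intro inj_onI) (metis matrix_vector_mul_assoc matrix_vector_mul_lid)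
  qed
  then have "h ` V = V" unfolding V_eq by (metis (mono_tags, lifting) h image_cong image_image)
  ultimately show ?thesis by (simp add: rotation_group_def)
qed

text \<open>An improper \<open>Q\<close> reverses the sense of rotation, which the factor
  \<open>det Q\<close> on the axis direction corrects.\<close>

lemma rotation_C_image:
  assumes u: "norm u = 1"
  shows "rotation_C n c (det Q *\<^sub>R (Q *v u)) (\<phi> x) = \<phi> (rotation_C n 0 u x)"
proof -
  have det2: "det Q * (det Q * k) = k" for k using det_orthogonal_matrix[OF Q] by auto
  have inner: "(Q *v a) \<bullet> (Q *v b) = a \<bullet> b" for a b
  proof -
    have "orthogonal_transformation ((*v) Q)"
      using Q by (simp add: orthogonal_transformation_matrix matrix_vector_mul_linear)
    then show ?thesis by (simp add: orthogonal_transformation_def)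
  qed
  have cross: "cross3 (det Q *\<^sub>R (Q *v u)) (Q *v x) = Q *v cross3 u x"
    using cross_orthogonal_matrix[OF Q, of u x] det2[of 1] by (simp add: cross_mult_left)
  show ?thesis
    unfolding rotation_C_def \<phi>_def
    by (simp add: cross_mult_right cross inner matrix_vector_right_distrib
        matrix_vector_mult_scaleR scaleR_add_right)
      (simp add: algebra_simps det2)
qed

text \<open>A symmetry of \<open>V\<close> fixes its centroid, and the centroid is \<open>c\<close>
  because \<open>W = -W\<close>.\<close>

lemma fixes_centre:
  assumes "f \<in> full_group V"
  obtains L where "orthogonal_matrix L" "\<And>x. f x = c + L *v (x - c)"
proof -
  have f: "isometry f" "f ` V = V" using assms by (auto simp: full_group_def)
  obtain a L where L: "orthogonal_matrix L" "f = (\<lambda>x. a + L *v x)" using isometryE[OF f(1)] .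
  have inj: "inj_on f V" using isometry_bij[OF f(1)] by (meson bij_is_inj inj_on_subset subset_UNIV)
  have "(\<Sum>w\<in>W. w) = (\<Sum>w\<in>W. - w)"
    by (rule sum.reindex_bij_witness[of _ uminus uminus]) (auto simp: W_sym)
  then have "(\<Sum>w\<in>W. w) = - (\<Sum>w\<in>W. w)" by (simp add: sum_negf)
  then have "(\<Sum>w\<in>W. w) $ i = - (\<Sum>w\<in>W. w) $ i" for i
    by (metis vector_uminus_component)
  then have W0: "(\<Sum>w\<in>W. w) = 0"
    by (simp only: vec_eq_iff zero_index equal_neg_zero) simp
  have "(\<Sum>v\<in>V. v - c) = (\<Sum>w\<in>W. r *\<^sub>R (Q *v w))"
    unfolding V_eq using inj_on_subset[OF inj_phi] by (subst sum.reindex) (auto simp: \<phi>_def)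
  also have "\<dots> = r *\<^sub>R (Q *v (\<Sum>w\<in>W. w))"
    by (simp add: scaleR_sum_right linear_sum[OF matrix_vector_mul_linear])
  finally have V0: "(\<Sum>v\<in>V. v - c) = 0" by (simp add: W0)
  have "(\<Sum>v\<in>V. v - c) = (\<Sum>v\<in>f ` V. v - c)" by (simp add: f(2))
  also have "\<dots> = (\<Sum>v\<in>V. f v - c)" using inj by (simp add: sum.reindex)
  also have "\<dots> = (\<Sum>v\<in>V. (f c - c) + L *v (v - c))"
    by (simp add: L matrix_vector_mult_diff_distrib algebra_simps)
  also have "\<dots> = real (card V) *\<^sub>R (f c - c) + L *v (\<Sum>v\<in>V. v - c)"
    by (simp add: sum.distrib linear_sum[OF matrix_vector_mul_linear] scaleR_right_diff_distrib
        sum_constant_scaleR del: sum_constant)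
  finally have "real (card V) *\<^sub>R (f c - c) = 0" by (simp add: V0)
  moreover have "card V \<noteq> 0" using finite_W W_ne by (simp add: V)
  ultimately have fc: "f c = c" by simp
  have "f x = c + L *v (x - c)" for x
    using fc by (simp add: L matrix_vector_mult_diff_distrib algebra_simps)
  with L(1) show ?thesis by (rule that)
qed

end

section \<open>Existence and uniqueness of the vertex orbit\<close>

lemma (in isostatic_framework) orbit_eq:
  assumes "x \<in> (\<lambda>f. f y) ` point_group ends p"
  shows "(\<lambda>f. f x) ` point_group ends p = (\<lambda>f. f y) ` point_group ends p"
proof -
  let ?G = "point_group ends p"
  have sub: "(\<lambda>f. f (g z)) ` ?G \<subseteq> (\<lambda>f. f z) ` ?G" if g: "g \<in> ?G" for g z
  proof clarify
    fix f assume "f \<in> ?G"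
    then show "f (g z) \<in> (\<lambda>f. f z) ` ?G"
      using point_group_comp[OF _ g] by (intro image_eqI[of _ _ "f \<circ> g"]) auto
  qed
  obtain g where g: "g \<in> ?G" "x = g y" using assms by blast
  then have "isometry g" by (simp add: point_group_def)
  then have "y = inv g x" using isometry_bij g by (simp add: bij_is_inj)
  then show ?thesis using sub[OF g(1), of y] sub[OF point_group_inv[OF g(1)], of x] g(2) by auto
qed

text \<open>Serves both solids, with \<open>W\<close> the standard vertices and \<open>n\<close> the
  order of the axis through \<open>w0\<close>. Bounding the point group between rotations and all
  symmetries of \<open>V\<close> handles the rotation group and the full group together.\<close>

lemma (in isostatic_framework) unique_vertex_orbit:
  assumes W: "finite W" "\<And>w. w \<in> W \<Longrightarrow> - w \<in> W" "w0 \<in> W" "w0 \<noteq> 0"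
    and trans: "\<And>w. w \<in> W \<Longrightarrow> \<exists>M. rotation_matrix M \<and> (*v) M ` W \<subseteq> W \<and> M *v w0 = w"
    and rot: "rotation_C n 0 (w0 /\<^sub>R norm w0) ` W \<subseteq> W"
    and n: "n \<ge> 4" "\<not> n dvd card W"
    and V: "similar W V"
    and G: "rotation_group V \<subseteq> point_group ends p" "point_group ends p \<subseteq> full_group V"
  shows "\<exists>!X. X \<in> joint_orbits (point_group ends p) p \<and> card X = card W \<and> similar W X"
proof -
  let ?G = "point_group ends p"
  obtain r c Q where rcQ: "r > 0" "orthogonal_matrix Q" "V = (\<lambda>x. c + r *\<^sub>R (Q *v x)) ` W"
    using V by (auto simp: similar_def)
  interpret similar_copy W V c r Q
    by unfold_locales (use W rcQ in auto)
  define a where "a = r *\<^sub>R (Q *v w0)"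
  define u0 where "u0 = w0 /\<^sub>R norm w0"
  define u where "u = det Q *\<^sub>R (Q *v u0)"
  have u0: "norm u0 = 1" using W(4) by (simp add: u0_def)
  have detQ: "\<bar>det Q\<bar> = 1" using det_orthogonal_matrix[OF Q] by auto
  have norm_Q: "norm (Q *v x) = norm x" for x
    using Q by (simp add: orthogonal_transformation_matrix orthogonal_transformation_norm
        matrix_vector_mul_linear)
  have u: "norm u = 1" by (simp add: u_def norm_Q u0 detQ)
  have a: "a \<noteq> 0" using W(4) r norm_Q[of w0] by (auto simp: a_def)
  have axis: "axis_line c u = axis_line c a"
  proof -
    have "u = (det Q / (r * norm w0)) *\<^sub>R a"
      using r by (simp add: u_def u0_def a_def matrix_vector_mult_scaleR divide_inverse)
    moreover have "det Q / (r * norm w0) \<noteq> 0" using detQ r W(4) by auto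
    ultimately show ?thesis by (simp add: axis_line_scale)
  qed

  \<comment> \<open>A rotation taking \<open>w0\<close> to \<open>w\<close> carries the whole axis
    line, so it also moves joints that are not vertices of \<open>V\<close>.\<close>
  have move: "\<exists>h\<in>?G. \<forall>s. h (c + s *\<^sub>R a) = c + s *\<^sub>R (r *\<^sub>R (Q *v w))" if "w \<in> W" for w
  proof -
    obtain M where M: "rotation_matrix M" "(*v) M ` W \<subseteq> W" "M *v w0 = w" using trans \<open>w \<in> W\<close> by blast
    define h where "h x = \<phi> (M *v inv \<phi> x)" for x
    have h: "h (\<phi> x) = \<phi> (M *v x)" for x by (simp add: h_def inj_phi)
    have "h \<in> ?G" using conjugate_rotation[OF M(1,2) h] G(1) by blast
    moreover have "h (c + s *\<^sub>R a) = c + s *\<^sub>R (r *\<^sub>R (Q *v w))" for s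
      using h[of "s *\<^sub>R w0"]
      by (simp add: \<phi>_def a_def matrix_vector_mult_scaleR M(3) mult.commute)
    ultimately show ?thesis by blast
  qed

  have g: "rotation_C n c u \<in> ?G"
  proof -
    define M where "M = matrix (axial_lin u0 (cis (2 * pi / real n)) 1)"
    have M: "M *v x = rotation_C n 0 u0 x" for x
      by (simp add: M_def matrix_works linear_axial_lin rotation_C_eq_axial axial_def)
    have "rotation_matrix M"
      by (simp add: M_def rotation_matrix_def orthogonal_matrix_axial_lin det_axial_lin u0)
    moreover have "(*v) M ` W \<subseteq> W" using rot by (simp add: M u0_def)
    moreover have "rotation_C n c u (\<phi> x) = \<phi> (M *v x)" for x
      by (simp add: M u_def rotation_C_image u0)
    ultimately show ?thesis using conjugate_rotation G(1) by blast
  qed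

  have "card (joints_in p (axis_line c a)) = 2"
    using rotation_order_gt_2[OF _ u g] n axis by auto
  then obtain v1 v2 where v12: "joints_in p (axis_line c a) = {v1, v2}" "v1 \<noteq> v2"
    by (auto simp: card_2_iff)
  then have "p v1 \<in> axis_line c a" "p v2 \<in> axis_line c a" by (auto simp: joints_in_def)
  then obtain s1 s2 where s12: "p v1 = c + s1 *\<^sub>R a" "p v2 = c + s2 *\<^sub>R a"
    by (auto simp: axis_line_def)
  have "s1 \<noteq> s2"
  proof
    assume "s1 = s2"
    then have "p v1 = p v2" using s12 by simp
    then show False using v12(2) by simp
  qed
  have on_axis: "t = s1 \<or> t = s2" if t: "c + t *\<^sub>R a \<in> range p" for t
  proof -
    obtain v where v: "c + t *\<^sub>R a = p v" using t by blast
    have "p v \<in> axis_line c a" unfolding v[symmetric] by (auto simp: axis_line_def)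
    then have "v = v1 \<or> v = v2" using v12(1) by (auto simp: joints_in_def)
    then have "c + t *\<^sub>R a = c + s1 *\<^sub>R a \<or> c + t *\<^sub>R a = c + s2 *\<^sub>R a" using v s12 by metis
    then show ?thesis using a by simp
  qed
  \<comment> \<open>The group element taking \<open>w0\<close> to \<open>- w0\<close> reverses the
    axis and permutes the two joints on it. As they are distinct, they are opposite about the
    centre.\<close>
  have "- s1 = s1 \<or> - s1 = s2" "- s2 = s1 \<or> - s2 = s2"
  proof -
    obtain h where h: "h \<in> ?G" "\<And>s. h (c + s *\<^sub>R a) = c + (- s) *\<^sub>R a"
      using move[OF W(2)[OF W(3)]] by (auto simp: a_def linear_neg[OF matrix_vector_mul_linear])
    have "h (p v) \<in> range p" for v using h(1) unfolding point_group_def by blast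
    from this[of v1] this[of v2] have "c + (- s1) *\<^sub>R a \<in> range p" "c + (- s2) *\<^sub>R a \<in> range p"
      unfolding s12 h(2) by auto
    then show "- s1 = s1 \<or> - s1 = s2" "- s2 = s1 \<or> - s2 = s2" using on_axis by blast+
  qed
  then have "s2 = - s1" "s1 \<noteq> 0" using \<open>s1 \<noteq> s2\<close> by auto
  \<comment> \<open>The joint with positive parameter is chosen because \<open>similar\<close>
    requires a positive scale factor.\<close>
  then obtain v s where s: "s > 0" "p v = c + s *\<^sub>R a" "\<And>t. c + t *\<^sub>R a \<in> range p \<Longrightarrow> t = s \<or> t = - s"
    using s12 on_axis by (metis neg_0_less_iff_less linorder_neqE_linordered_idom minus_minus)

  define X0 where "X0 = (\<lambda>f. f (p v)) ` ?G"
  \<comment> \<open>Group elements fix \<open>c\<close> and permute \<open>V\<close>, so their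
    linear parts send \<open>a\<close> to vertex directions only; by \<open>move\<close> every
    vertex direction is reached.\<close>
  have X0: "X0 = (\<lambda>w. c + (s * r) *\<^sub>R (Q *v w)) ` W"
  proof
    show "X0 \<subseteq> (\<lambda>w. c + (s * r) *\<^sub>R (Q *v w)) ` W"
    proof
      fix x assume "x \<in> X0"
      then obtain f where f: "f \<in> ?G" "x = f (p v)" by (auto simp: X0_def)
      then have fV: "f \<in> full_group V" using G(2) by blast
      then obtain L where L: "\<And>x. f x = c + L *v (x - c)" using fixes_centre by metis
      have "c + a \<in> V" using W(3) by (auto simp: V_eq \<phi>_def a_def)
      then have "f (c + a) \<in> V" using fV by (auto simp: full_group_def)
      then obtain w where "w \<in> W" "L *v a = r *\<^sub>R (Q *v w)" by (auto simp: V_eq \<phi>_def L)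
      then show "x \<in> (\<lambda>w. c + (s * r) *\<^sub>R (Q *v w)) ` W"
        by (auto simp: f L s(2) matrix_vector_mult_scaleR)
    qed
    show "(\<lambda>w. c + (s * r) *\<^sub>R (Q *v w)) ` W \<subseteq> X0"
    proof clarify
      fix w assume "w \<in> W"
      then obtain h where "h \<in> ?G" "h (p v) = c + s *\<^sub>R (r *\<^sub>R (Q *v w))" using move s(2) by metis
      then show "c + (s * r) *\<^sub>R (Q *v w) \<in> X0" by (auto simp: X0_def intro!: image_eqI[of _ _ h])
    qed
  qed
  show ?thesis
  proof (rule ex1I[of _ X0], intro conjI)
    show "X0 \<in> joint_orbits ?G p" by (auto simp: joint_orbits_def X0_def)
    have "inj_on (\<lambda>w. c + (s * r) *\<^sub>R (Q *v w)) W"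
    proof (rule inj_onI)
      fix x y assume "c + (s * r) *\<^sub>R (Q *v x) = c + (s * r) *\<^sub>R (Q *v y)"
      then have "Q *v x = Q *v y" using s(1) r by simp
      then show "x = y" by (metis Q_inv(2))
    qed
    then show "card X0 = card W" by (simp add: X0 card_image)
    show "similar W X0"
      unfolding similar_def X0 using s(1) r Q by (intro exI[of _ "s * r"] exI[of _ c] exI[of _ Q]) simp
  next
    fix X assume X: "X \<in> joint_orbits ?G p \<and> card X = card W \<and> similar W X"
    then obtain w where w: "X = (\<lambda>f. f (p w)) ` ?G" by (auto simp: joint_orbits_def)
    have X_joints: "X \<subseteq> range p" using w by (auto simp: point_group_def)
    then have "finite X" by (rule finite_subset) simp
    moreover have "rotation_C n c u ` X \<subseteq> X"
      unfolding w using point_group_comp[OF g] by (auto intro!: image_eqI[of _ _ "rotation_C n c u \<circ> _"])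
    ultimately have "n dvd card (X - axis_line c u)"
      using dvd_card_off_axis[OF u] n by simp
    \<comment> \<open>An orbit avoiding the axis would have size divisible by \<open>n\<close>,
      unlike \<open>card W\<close>. The only joints available on the axis are \<open>p v\<close> and
      its opposite, both in \<open>X0\<close>.\<close>
    then have "X \<inter> axis_line c u \<noteq> {}" using n(2) X by (metis Diff_triv)
    then obtain x where x: "x \<in> X" "x \<in> axis_line c a" using axis by auto
    then obtain t where t: "x = c + t *\<^sub>R a" by (auto simp: axis_line_def)
    have "t = s \<or> t = - s" using x(1) X_joints unfolding t by (intro s(3)) blast
    then have "x = c + (s * r) *\<^sub>R (Q *v w0) \<or> x = c + (s * r) *\<^sub>R (Q *v (- w0))"
      by (auto simp: t a_def linear_neg[OF matrix_vector_mul_linear])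
    then have "x \<in> X0" unfolding X0 using W(2,3) by blast
    then show "X = X0" using orbit_eq x(1) unfolding X0_def w by metis
  qed
qed

section \<open>The standard octahedron and icosahedron\<close>

text \<open>The twelve rotations of a tetrahedron: cyclic coordinate permutations, which are even,
  with signs \<open>s\<close>, \<open>t\<close>, \<open>s * t\<close> of product 1. They act
  transitively on the vertices of both solids.\<close>

lemma signed_cyclic_rotations:
  fixes s t :: real
  assumes "s\<^sup>2 = 1" "t\<^sup>2 = 1"
  shows "\<exists>M :: real^3^3. rotation_matrix M \<and> (\<forall>x. M *v x = vector [s * t * x $ 1, s * x $ 2, t * x $ 3])" (is ?A)
    and "\<exists>M :: real^3^3. rotation_matrix M \<and> (\<forall>x. M *v x = vector [s * x $ 2, t * x $ 3, s * t * x $ 1])" (is ?B)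
    and "\<exists>M :: real^3^3. rotation_matrix M \<and> (\<forall>x. M *v x = vector [t * x $ 3, s * t * x $ 1, s * x $ 2])" (is ?C)
proof -
  have st: "s * s = 1" "t * t = 1" "s * (s * k) = k" "t * (t * k) = k" for k
    using assms by (simp_all add: power2_eq_square flip: mult.assoc)
  note simps = rotation_matrix_def orthogonal_matrix matrix_matrix_mult_def transpose_def mat_def
    vec_eq_iff forall_3 sum_3 det_3 matrix_vector_mult_def st
  show ?A
    by (rule exI[of _ "vector [vector [s * t, 0, 0], vector [0, s, 0], vector [0, 0, t]]"])
      (simp add: simps algebra_simps)
  show ?B
    by (rule exI[of _ "vector [vector [0, s, 0], vector [0, 0, t], vector [s * t, 0, 0]]"])
      (simp add: simps algebra_simps)
  show ?C
    by (rule exI[of _ "vector [vector [0, 0, t], vector [s * t, 0, 0], vector [0, s, 0]]"])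
      (simp add: simps algebra_simps)
qed

lemma vector_3_eq_iff:
  "(vector [x, y, z] :: real^3) = vector [x', y', z'] \<longleftrightarrow> x = x' \<and> y = y' \<and> z = z'"
  by (simp add: vec_eq_iff forall_3)

lemma uminus_vector_3: "- vector [x, y, z] = (vector [- x, - y, - z] :: real^3)"
  by (simp add: vec_eq_iff forall_3)

lemma std_octahedron_eq:
  "std_octahedron = {vector [1, 0, 0], vector [0, 1, 0], vector [0, 0, 1],
     vector [-1, 0, 0], vector [0, -1, 0], vector [0, 0, -1]}"
proof -
  have B: "(Basis :: (real^3) set) = {vector [1, 0, 0], vector [0, 1, 0], vector [0, 0, 1]}"
  proof -
    have "(axis 1 1 :: real^3) = vector [1, 0, 0]" "(axis 2 1 :: real^3) = vector [0, 1, 0]"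
      "(axis 3 1 :: real^3) = vector [0, 0, 1]"
      by (simp_all add: vec_eq_iff forall_3 axis_def)
    then show ?thesis by (auto simp: Basis_vec_def UNIV_3)
  qed
  show ?thesis
    unfolding std_octahedron_def B by (auto simp: uminus_vector_3)
qed

lemma card_std_octahedron: "card std_octahedron = 6"
  by (simp add: std_octahedron_eq vec_eq_iff forall_3)

lemma std_octahedron_transitive:
  assumes "w \<in> std_octahedron"
  shows "\<exists>M. rotation_matrix M \<and> (*v) M ` std_octahedron \<subseteq> std_octahedron \<and> M *v vector [0, 0, 1] = w"
proof -
  have "\<exists>t. t\<^sup>2 = (1::real) \<and> (w = vector [0, 0, t] \<or> w = vector [0, t, 0] \<or> w = vector [t, 0, 0])"
    using assms unfolding std_octahedron_eq by (auto simp: vector_3_eq_iff intro: exI[of _ 1] exI[of _ "-1"])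
  then obtain t :: real where t: "t\<^sup>2 = 1"
    "w = vector [0, 0, t] \<or> w = vector [0, t, 0] \<or> w = vector [t, 0, 0]" by blast
  have t1: "t = 1 \<or> t = -1" using t(1) by (simp add: power2_eq_1_iff)
  from t(2) show ?thesis
  proof (elim disjE)
    assume w: "w = vector [0, 0, t]"
    obtain M :: "real^3^3" where "rotation_matrix M" "\<And>x. M *v x = vector [1 * t * x $ 1, 1 * x $ 2, t * x $ 3]"
      using signed_cyclic_rotations(1)[of 1 t] t(1) by auto
    then show ?thesis using t1 by (intro exI[of _ M]) (auto simp: w std_octahedron_eq)
  next
    assume w: "w = vector [0, t, 0]"
    obtain M :: "real^3^3" where "rotation_matrix M" "\<And>x. M *v x = vector [1 * x $ 2, t * x $ 3, 1 * t * x $ 1]"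
      using signed_cyclic_rotations(2)[of 1 t] t(1) by auto
    then show ?thesis using t1 by (intro exI[of _ M]) (auto simp: w std_octahedron_eq)
  next
    assume w: "w = vector [t, 0, 0]"
    obtain M :: "real^3^3" where "rotation_matrix M" "\<And>x. M *v x = vector [t * x $ 3, 1 * t * x $ 1, 1 * x $ 2]"
      using signed_cyclic_rotations(3)[of 1 t] t(1) by auto
    then show ?thesis using t1 by (intro exI[of _ M]) (auto simp: w std_octahedron_eq)
  qed
qed

lemma std_octahedron_rotation:
  "rotation_C 4 0 (vector [0, 0, 1]) ` std_octahedron \<subseteq> std_octahedron"
proof -
  have "rotation_C 4 0 (vector [0, 0, 1]) x = vector [- (x $ 2), x $ 1, x $ 3]" for x
    by (simp add: rotation_C_def vec_eq_iff forall_3 cross3_def inner_vec_def sum_3)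
  then show ?thesis by (auto simp: std_octahedron_eq)
qed

section \<open>The icosahedron and the golden ratio\<close>

definition golden :: real where "golden = (1 + sqrt 5) / 2"

lemma golden_square: "golden * golden = golden + 1"
  by (simp add: golden_def field_simps)

lemma golden_gt_1: "golden > 1"
  by (simp add: golden_def real_less_rsqrt)

lemma std_icosahedron_eq:
  "std_icosahedron =
     {vector [0, 1, golden], vector [0, 1, - golden], vector [0, -1, golden], vector [0, -1, - golden],
      vector [1, golden, 0], vector [1, - golden, 0], vector [-1, golden, 0], vector [-1, - golden, 0],
      vector [golden, 0, 1], vector [golden, 0, -1], vector [- golden, 0, 1], vector [- golden, 0, -1]}"
  unfolding std_icosahedron_def Let_def golden_def[symmetric] by auto

lemma card_std_icosahedron: "card std_icosahedron = 12"
  using golden_gt_1 unfolding std_icosahedron_eq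
  by (subst card_insert_disjoint; simp add: vector_3_eq_iff)+

lemma std_icosahedron_transitive:
  assumes "w \<in> std_icosahedron"
  shows "\<exists>M. rotation_matrix M \<and> (*v) M ` std_icosahedron \<subseteq> std_icosahedron \<and>
    M *v vector [0, 1, golden] = w"
proof -
  have "\<exists>s t. s\<^sup>2 = (1::real) \<and> t\<^sup>2 = (1::real) \<and> (w = vector [0, s, t * golden] \<or>
      w = vector [s, t * golden, 0] \<or> w = vector [t * golden, 0, s])"
    using assms unfolding std_icosahedron_def Let_def golden_def[symmetric] by force
  then obtain s t :: real where st2: "s\<^sup>2 = 1" "t\<^sup>2 = 1" and
    w: "w = vector [0, s, t * golden] \<or> w = vector [s, t * golden, 0] \<or> w = vector [t * golden, 0, s]"
    by blast
  have st: "s = 1 \<or> s = -1" "t = 1 \<or> t = -1" using st2 by (simp_all add: power2_eq_1_iff)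
  from w show ?thesis
  proof (elim disjE)
    assume w: "w = vector [0, s, t * golden]"
    obtain M :: "real^3^3" where "rotation_matrix M" "\<And>x. M *v x = vector [s * t * x $ 1, s * x $ 2, t * x $ 3]"
      using signed_cyclic_rotations(1)[OF st2] by auto
    then show ?thesis using st by (intro exI[of _ M]) (elim disjE; simp add: w std_icosahedron_eq)
  next
    assume w: "w = vector [s, t * golden, 0]"
    obtain M :: "real^3^3" where "rotation_matrix M" "\<And>x. M *v x = vector [s * x $ 2, t * x $ 3, s * t * x $ 1]"
      using signed_cyclic_rotations(2)[OF st2] by auto
    then show ?thesis using st by (intro exI[of _ M]) (elim disjE; simp add: w std_icosahedron_eq)
  next
    assume w: "w = vector [t * golden, 0, s]"
    obtain M :: "real^3^3" where "rotation_matrix M" "\<And>x. M *v x = vector [t * x $ 3, s * t * x $ 1, s * x $ 2]"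
      using signed_cyclic_rotations(3)[OF st2] by auto
    then show ?thesis using st by (intro exI[of _ M]) (elim disjE; simp add: w std_icosahedron_eq)
  qed
qed

lemma cos_72: "cos (2 * pi / 5) = (golden - 1) / 2"
proof -
  define t where "t = 2 * pi / 5"
  define x where "x = cos t"
  have x: "0 < x" "x < 1"
    using cos_gt_zero[of t] cos_monotone_0_pi[of 0 t] by (auto simp: x_def t_def)
  \<comment> \<open>Since \<open>5 * t = 2 * pi\<close>, this gives a cubic for \<open>x\<close>
    with the spurious root 1. The quadratic left over has roots \<open>(golden - 1) / 2\<close> and
    \<open>- golden / 2\<close>, of which only the first is positive.\<close>
  have "cos (3 * t) = cos (2 * pi - 2 * t)" by (simp add: t_def field_simps)
  also have "\<dots> = cos (2 * t)" by (simp add: cos_2pi_minus)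
  finally have "4 * x ^ 3 - 3 * x = 2 * x\<^sup>2 - 1"
    by (simp add: cos_treble_cos cos_double_cos x_def)
  then have "(x - 1) * (4 * x * x + 2 * x - 1) = 0"
    by (simp add: algebra_simps power2_eq_square power3_eq_cube)
  then have "4 * x * x + 2 * x - 1 = 0" using x by simp
  then have "(2 * x - (golden - 1)) * (2 * x + golden) = 0"
    using golden_square by (simp add: algebra_simps)
  moreover have "2 * x + golden > 0" using x golden_gt_1 by simp
  ultimately show ?thesis by (simp add: x_def t_def)
qed

text \<open>Moves the normalisation of the axis into the coefficients, where for the icosahedron the
  square root in the norm cancels.\<close>

lemma rotation_C_scaled_axis:
  "rotation_C n c (w /\<^sub>R N) x = c + cos (2 * pi / real n) *\<^sub>R (x - c)
     + (sin (2 * pi / real n) / N) *\<^sub>R cross3 w (x - c)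
     + ((1 - cos (2 * pi / real n)) / (N * N) * (w \<bullet> (x - c))) *\<^sub>R w"
proof -
  have "a * (inverse N * d) * inverse N = a / (N * N) * d" "a * inverse N = a / N" for a d
    by (simp_all add: field_simps)
  then show ?thesis
    by (simp only: rotation_C_def cross_mult_left inner_scaleR_left scaleR_scaleR)
qed

lemma std_icosahedron_rotation:
  defines "w0 \<equiv> (vector [0, 1, golden] :: real^3)"
  shows "rotation_C 5 0 (w0 /\<^sub>R norm w0) ` std_icosahedron \<subseteq> std_icosahedron"
proof -
  define N where "N = norm w0"
  have N2: "N * N = golden + 2"
    unfolding N_def
    using golden_square
    by (simp add: w0_def inner_vec_def sum_3 power2_norm_eq_inner flip: power2_eq_square[of "norm _"])
  have "N \<noteq> 0" using N2 golden_gt_1 by auto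
  then have N: "N > 0" by (simp add: N_def)
  \<comment> \<open>The sine is exactly half the norm \<open>N\<close>, so
    \<open>sin (2 * pi / 5) / N = 1 / 2\<close>.\<close>
  have sin: "sin (2 * pi / 5) = N / 2"
  proof -
    have "(sin (2 * pi / 5))\<^sup>2 = 1 - ((golden - 1) / 2)\<^sup>2"
      by (simp add: sin_squared_eq cos_72)
    also have "\<dots> = (N / 2)\<^sup>2"
      using N2 golden_square by (simp add: power2_eq_square field_simps)
    finally show ?thesis
      using N sin_gt_zero[of "2 * pi / 5"] by (simp add: power2_eq_iff_nonneg)
  qed
  have cos1: "(1 - cos (2 * pi / 5)) / (N * N) = (2 - golden) / 2"
    unfolding N2 cos_72 using golden_gt_1 golden_square by (simp add: field_simps)
  have rot: "2 *\<^sub>R rotation_C 5 0 (w0 /\<^sub>R N) x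
      = (golden - 1) *\<^sub>R x + cross3 w0 x + ((2 - golden) * (w0 \<bullet> x)) *\<^sub>R w0" for x
  proof -
    have *: "rotation_C 5 0 (w0 /\<^sub>R N) x = cos (2 * pi / 5) *\<^sub>R x
        + (sin (2 * pi / 5) / N) *\<^sub>R cross3 w0 x
        + ((1 - cos (2 * pi / 5)) / (N * N) * (w0 \<bullet> x)) *\<^sub>R w0"
      using rotation_C_scaled_axis[of 5 0 N w0 x] by simp
    have sin1: "sin (2 * pi / 5) / N = 1 / 2" using N by (simp add: sin)
    have "2 * ((golden - 1) / 2) = golden - 1" "2 * ((2 - golden) / 2 * k) = (2 - golden) * k" for k
      by simp_all
    then show ?thesis
      unfolding * cos1 unfolding sin1 cos_72 by (simp only: scaleR_add_right scaleR_scaleR) simp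
  qed
  \<comment> \<open>The entries of the doubled matrix are integer combinations of 1 and
    \<open>golden\<close>, so invariance reduces to twelve checks by
    \<open>golden_square\<close>.\<close>
  have rot': "rotation_C 5 0 (w0 /\<^sub>R N) x = vector
      [((golden - 1) * x $ 1 - golden * x $ 2 + x $ 3) / 2,
       (golden * x $ 1 + x $ 2 + (golden - 1) * x $ 3) / 2,
       (- x $ 1 + (golden - 1) * x $ 2 + golden * x $ 3) / 2]" (is "_ = ?y") for x
  proof -
    have gg: "golden * (golden * k) = golden * k + k" for k
      using arg_cong[OF golden_square, of "\<lambda>y. y * k"] by (simp add: algebra_simps)
    have "2 *\<^sub>R rotation_C 5 0 (w0 /\<^sub>R N) x = vector
      [(golden - 1) * x $ 1 - golden * x $ 2 + x $ 3,
       golden * x $ 1 + x $ 2 + (golden - 1) * x $ 3,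
       - x $ 1 + (golden - 1) * x $ 2 + golden * x $ 3]"
      unfolding rot
      by (simp add: w0_def vec_eq_iff forall_3 cross3_def inner_vec_def sum_3 algebra_simps golden_square gg)
    also have "\<dots> = 2 *\<^sub>R ?y" by (simp add: vec_eq_iff forall_3)
    finally have "2 *\<^sub>R rotation_C 5 0 (w0 /\<^sub>R N) x = 2 *\<^sub>R ?y" .
    then show ?thesis by simp
  qed
  have "rotation_C 5 0 (w0 /\<^sub>R N) x \<in> std_icosahedron" if "x \<in> std_icosahedron" for x
    using that unfolding rot' std_icosahedron_eq
    by (elim insertE emptyE; simp add: vector_3_eq_iff algebra_simps golden_square)
  then show ?thesis unfolding N_def by blast
qed

section \<open>Icosahedral and octahedral point groups, and the combined result\<close>

context isostatic_framework begin

lemma point_group_between: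
  assumes "point_group ends p = rotation_group V \<or> point_group ends p = full_group V"
  shows "rotation_group V \<subseteq> point_group ends p" "point_group ends p \<subseteq> full_group V"
proof -
  have "rotation_group V \<subseteq> full_group V"
    by (auto simp: rotation_group_def full_group_def proper_isometry_def rotation_matrix_def
        isometry_orthogonal_matrix)
  then show "rotation_group V \<subseteq> point_group ends p" "point_group ends p \<subseteq> full_group V"
    using assms by auto
qed

lemma unique_icosahedron:
  assumes "is_I (point_group ends p) \<or> is_Ih (point_group ends p)"
  shows "\<exists>!X. X \<in> joint_orbits (point_group ends p) p \<and> card X = 12 \<and> icosahedron_vertices X"
proof -
  obtain V where V: "similar std_icosahedron V"
    "point_group ends p = rotation_group V \<or> point_group ends p = full_group V"
    using assms by (auto simp: is_I_def is_Ih_def icosahedron_vertices_def)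
  have "\<exists>!X. X \<in> joint_orbits (point_group ends p) p \<and> card X = card std_icosahedron
      \<and> similar std_icosahedron X"
  \<comment> \<open>Here \<open>n = 5\<close>, which does not divide 12.\<close>
  proof (rule unique_vertex_orbit[OF _ _ _ _ std_icosahedron_transitive std_icosahedron_rotation _ _
        V(1) point_group_between[OF V(2)]])
    show "finite std_icosahedron" by (simp add: std_icosahedron_eq)
    show "- w \<in> std_icosahedron" if "w \<in> std_icosahedron" for w
      using that by (auto simp: std_icosahedron_eq uminus_vector_3)
    show "vector [0, 1, golden] \<in> std_icosahedron" by (simp add: std_icosahedron_eq)
  qed (auto simp: card_std_icosahedron vec_eq_iff forall_3)
  then show ?thesis by (simp add: card_std_icosahedron icosahedron_vertices_def)
qed

lemma unique_octahedron:
  assumes "is_O (point_group ends p) \<or> is_Oh (point_group ends p)"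
  shows "\<exists>!X. X \<in> joint_orbits (point_group ends p) p \<and> card X = 6 \<and> octahedron_vertices X"
proof -
  obtain V where V: "similar std_octahedron V"
    "point_group ends p = rotation_group V \<or> point_group ends p = full_group V"
    using assms by (auto simp: is_O_def is_Oh_def octahedron_vertices_def)
  have "\<exists>!X. X \<in> joint_orbits (point_group ends p) p \<and> card X = card std_octahedron
      \<and> similar std_octahedron X"
  \<comment> \<open>Here \<open>n = 4\<close>, which does not divide 6.\<close>
  proof (rule unique_vertex_orbit[OF _ _ _ _ std_octahedron_transitive _ _ _
        V(1) point_group_between[OF V(2)]])
    show "finite std_octahedron" by (simp add: std_octahedron_eq)
    show "- w \<in> std_octahedron" if "w \<in> std_octahedron" for w
      using that by (auto simp: std_octahedron_eq uminus_vector_3)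
    show "vector [0, 0, 1] \<in> std_octahedron" by (simp add: std_octahedron_eq)
    have "norm (vector [0, 0, 1] :: real^3) = 1" by (simp add: norm_eq_1 inner_vec_def sum_3)
    then show "rotation_C 4 0 (vector [0, 0, 1] /\<^sub>R norm (vector [0, 0, 1] :: real^3)) ` std_octahedron
        \<subseteq> std_octahedron"
      using std_octahedron_rotation by simp
  qed (auto simp: card_std_octahedron vec_eq_iff forall_3)
  then show ?thesis by (simp add: card_std_octahedron octahedron_vertices_def)
qed

end

theorem mainTheorem2:
  fixes ends :: "'b::finite \<Rightarrow> 'j::finite set"
    and p :: "'j \<Rightarrow> real^3"
    and G :: "(real^3 \<Rightarrow> real^3) set"
  assumes "framework ends p"
    and "CARD('j) > 3"
    and "isostatic ends p"
    and "G = point_group ends p"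
  shows
    \<comment> \<open>(i)\<close>
    "int CARD('b) = 3 * int CARD('j) - 6
    \<and> \<comment> \<open>(ii)\<close>
     (\<forall>c u. norm u = 1 \<and> reflection c u \<in> G \<longrightarrow>
        card (unshifted_bars ends p (reflection c u)) = card (joints_in p (perp_plane c u)))
    \<and> \<comment> \<open>(iii)\<close>
     (\<forall>c. inversion c \<in> G \<longrightarrow>
        card (joints_in p {c}) = 0 \<and> card (unshifted_bars ends p (inversion c)) = 0)
    \<and> \<comment> \<open>(iv)\<close>
     (\<forall>c u. norm u = 1 \<and> rotation_C 2 c u \<in> G \<longrightarrow>
        (card (joints_in p (axis_line c u)), card (unshifted_bars ends p (rotation_C 2 c u)))
          \<in> {(2, 0), (1, 1), (0, 2)}
        \<and> (\<forall>e \<in> unshifted_bars ends p (rotation_C 2 c u).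
             (\<forall>v \<in> ends e. \<forall>w \<in> ends e. orthogonal u (p v - p w))
             \<and> \<not> p ` ends e \<subseteq> axis_line c u))
    \<and> \<comment> \<open>(v)\<close>
     (\<forall>n c u. n > 2 \<and> norm u = 1 \<and> rotation_C n c u \<in> G \<longrightarrow>
        card (unshifted_bars ends p (rotation_C n c u)) = 0
        \<and> (n \<noteq> 3 \<longrightarrow> card (joints_in p (axis_line c u)) = 2))
    \<and> \<comment> \<open>(vi)\<close>
     (\<forall>n c u. n > 2 \<and> norm u = 1 \<and> improper_S n c u \<in> G \<longrightarrow>
        card (joints_in p {c}) = 0 \<and> card (unshifted_bars ends p (improper_S n c u)) = 0)
    \<and> \<comment> \<open>(vii)\<close>
     (is_I G \<or> is_Ih G \<longrightarrow>
        (\<forall>c u. norm u = 1 \<and> rotation_C 5 c u \<in> G \<longrightarrow> card (joints_in p (axis_line c u)) = 2)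
        \<and> (\<exists>!X. X \<in> joint_orbits G p \<and> card X = 12 \<and> icosahedron_vertices X))
    \<and> (is_O G \<or> is_Oh G \<longrightarrow>
        (\<forall>c u. norm u = 1 \<and> rotation_C 4 c u \<in> G \<longrightarrow> card (joints_in p (axis_line c u)) = 2)
        \<and> (\<exists>!X. X \<in> joint_orbits G p \<and> card X = 6 \<and> octahedron_vertices X))"
proof -
  interpret isostatic_framework ends p
    using assms(1-3) by unfold_locales
  show ?thesis
    unfolding assms(4)
  proof (intro conjI)
    show "int CARD('b) = 3 * int CARD('j) - 6" by (rule card_bars)
    show "\<forall>c u. norm u = 1 \<and> reflection c u \<in> point_group ends p \<longrightarrow>
        card (unshifted_bars ends p (reflection c u)) = card (joints_in p (perp_plane c u))"
      using count_reflection by (simp add: reflection_eq_axial)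
    \<comment> \<open>The axial form of the inversion needs some unit direction;
      \<open>axis 1 1\<close> is an arbitrary choice.\<close>
    show "\<forall>c. inversion c \<in> point_group ends p \<longrightarrow>
        card (joints_in p {c}) = 0 \<and> card (unshifted_bars ends p (inversion c)) = 0"
      using no_centre_inversion[of "axis 1 1"] by (simp add: inversion_eq_axial[of _ "axis 1 1"])
    show "\<forall>c u. norm u = 1 \<and> rotation_C 2 c u \<in> point_group ends p \<longrightarrow>
        (card (joints_in p (axis_line c u)), card (unshifted_bars ends p (rotation_C 2 c u)))
          \<in> {(2, 0), (1, 1), (0, 2)}
        \<and> (\<forall>e \<in> unshifted_bars ends p (rotation_C 2 c u).
             (\<forall>v \<in> ends e. \<forall>w \<in> ends e. orthogonal u (p v - p w))
             \<and> \<not> p ` ends e \<subseteq> axis_line c u)"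
    proof (intro allI impI, elim conjE)
      fix c u assume u: "norm u = 1" and "rotation_C 2 c u \<in> point_group ends p"
      moreover have eq: "rotation_C 2 c u = axial c u (-1) 1" by (simp add: rotation_C_eq_axial)
      ultimately have f: "axial c u (-1) 1 \<in> point_group ends p" by simp
      have "(i, k) \<in> {(2, 0), (1, 1), (0, 2)}" if "i + k = 2" for i k :: nat
        using that by auto
      from this[OF half_turn(1)[OF u f]] half_turn(2,3)[OF u f]
      show "(card (joints_in p (axis_line c u)), card (unshifted_bars ends p (rotation_C 2 c u)))
          \<in> {(2, 0), (1, 1), (0, 2)}
        \<and> (\<forall>e \<in> unshifted_bars ends p (rotation_C 2 c u).
             (\<forall>v \<in> ends e. \<forall>w \<in> ends e. orthogonal u (p v - p w))
             \<and> \<not> p ` ends e \<subseteq> axis_line c u)"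
        unfolding eq by blast
    qed
    show "\<forall>n c u. n > 2 \<and> norm u = 1 \<and> rotation_C n c u \<in> point_group ends p \<longrightarrow>
        card (unshifted_bars ends p (rotation_C n c u)) = 0
        \<and> (n \<noteq> 3 \<longrightarrow> card (joints_in p (axis_line c u)) = 2)"
      using rotation_order_gt_2 by blast
    show "\<forall>n c u. n > 2 \<and> norm u = 1 \<and> improper_S n c u \<in> point_group ends p \<longrightarrow>
        card (joints_in p {c}) = 0 \<and> card (unshifted_bars ends p (improper_S n c u)) = 0"
    proof (intro allI impI, elim conjE)
      fix n :: nat and c u
      assume n: "n > 2" and u: "norm u = 1" and f: "improper_S n c u \<in> point_group ends p"
      have "sin (2 * pi / real n) > 0"
        using n by (intro sin_gt_zero) (auto simp: field_simps)
      then have "cis (2 * pi / real n) \<noteq> 1" by (auto simp: complex_eq_iff)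
      then show "card (joints_in p {c}) = 0 \<and> card (unshifted_bars ends p (improper_S n c u)) = 0"
        using no_centre_improper[OF u norm_cis] f by (simp add: improper_S_eq_axial u)
    qed
    show "is_I (point_group ends p) \<or> is_Ih (point_group ends p) \<longrightarrow>
        (\<forall>c u. norm u = 1 \<and> rotation_C 5 c u \<in> point_group ends p \<longrightarrow>
          card (joints_in p (axis_line c u)) = 2)
        \<and> (\<exists>!X. X \<in> joint_orbits (point_group ends p) p \<and> card X = 12 \<and> icosahedron_vertices X)"
      using rotation_order_gt_2[of 5] unique_icosahedron by simp
    show "is_O (point_group ends p) \<or> is_Oh (point_group ends p) \<longrightarrow>
        (\<forall>c u. norm u = 1 \<and> rotation_C 4 c u \<in> point_group ends p \<longrightarrow>
          card (joints_in p (axis_line c u)) = 2)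
        \<and> (\<exists>!X. X \<in> joint_orbits (point_group ends p) p \<and> card X = 6 \<and> octahedron_vertices X)"
      using rotation_order_gt_2[of 4] unique_octahedron by simp
  qed
qed

end
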